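(* Let $\mathbb K$ be a commutative unital ring, $(U,V)$ a linear set over $\mathbb K$, $n\in\mathbb N$, $\mathbf t=(t_1,\dots,t_n)\in\mathbb K^n$, $\mathsf n=\{1,\dots,n\}$. For $\gamma\subset\mathsf n$ and $v\in V$ write $\mathbf t.v_\gamma=(\prod_{i\in\gamma}t_i)v_\gamma$. The $n$-fold groupoid $\mathsf{Gsy}^{\mathsf n}_{\mathbf t}U$ has the following structure. (1) For $\alpha\subset\mathsf n$ the vertex set $\mathsf{Gsy}^{\alpha;\mathsf n}_{\mathbf t}U$ is $U^{\alpha;\mathsf n}_{\mathbf t}=\{(v_\beta)_{\beta\subset\alpha}: v_\beta\in V,\ \forall\beta\subset\alpha:\ \sum_{\gamma\subset\beta}\mathbf t.v_\gamma\in U\}$; in particular the bottom vertex set is $U^{\emptyset;\mathsf n}_{\mathbf t}=U$. (2) For an edge $(\beta,\alpha)$ with $\alpha=\beta\cup\{i\}$, $i\notin\beta$, the source and target are $\pi_0((v_\gamma)_{\gamma\subset\alpha})=(v_\gamma)_{\gamma\subset\beta}$ and $\pi_1((v_\gamma)_{\gamma\subset\alpha})=(v_\gamma+t_iv_{\gamma\cup\{i\}})_{\gamma\subset\beta}$; the unit section sends $(v_\gamma)_{\gamma\subset\beta}$ to the family indexed by $\gamma\subset\alpha$ extended by $0$ at all $\gamma\ni i$; and the composition $(v'_\gamma)*(v_\gamma)=(w_\gamma)_{\gamma\subset\alpha}$ is given, for $\gamma\subset\beta$, by $w_\gamma=v_\gamma$ and $w_{\gamma\cup\{i\}}=v_{\gamma\cup\{i\}}+v'_{\gamma\cup\{i\}}$.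 (3) The $2^{|\alpha|}$ top-down projections from $U^{\alpha;\mathsf n}_{\mathbf t}$ to the bottom vertex set $U$, obtained by composing source and target maps, are, for $\beta\subset\alpha$, $\xi_{\alpha,\beta}:(v_\gamma)_{\gamma\subset\alpha}\mapsto x_\beta:=\sum_{\gamma\subset\beta}\mathbf t.v_\gamma$ (target used in directions $i\in\beta$, source in directions $i\in\alpha\setminus\beta$). (4) For $n=2$ the flip $(v_0,v_1,v_2,v_{12})\mapsto(v_0,v_2,v_1,v_{12})$ is an isomorphism of double groupoids from $\mathsf{Gsy}^{\mathsf 2}_{t_1,t_2}U$ onto $\mathsf{Gsy}^{\mathsf 2}_{t_2,t_1}U$ (with the two directions exchanged); in particular, when $t_1=t_2$ the double groupoid is edge-symmetric. (5) For every $n$ and every permutation $\sigma$ of $\mathsf n$, the map $(v_\alpha)_{\alpha\subset\mathsf n}\mapsto(v_{\sigma(\alpha)})_{\alpha\subset\mathsf n}$ induces an isomorphism of $n$-fold groupoids $\mathsf{Gsy}^{\mathsf n}_{(t_1,\dots,t_n)}U\to\mathsf{Gsy}^{\mathsf n}_{(t_{\sigma(1)},\dots,t_{\sigma(n)})}U$ (with directions permuted accordingly: vertex $\sigma(\alpha)$ of the source corresponds to vertex $\alpha$ of the target), and for $t_1=\dots=t_n$ the $n$-fold groupoid $\mathsf{Gsy}^{\mathsf n}_{\mathbf t}U$ is edge-symmetric. (6) For linear sets $U\subset V$, $U'\subset W$ there is a natural isomorphism of $n$-fold groupoids $\mathsf{Gsy}^{\mathsf n}_{\mathbf t}(U\times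 U')\cong\mathsf{Gsy}^{\mathsf n}_{\mathbf t}U\times\mathsf{Gsy}^{\mathsf n}_{\mathbf t}U'$.
   Context: A linear set is a pair $(U,V)$, $V$ a $\mathbb K$-module, $U\subset V$. Groupoids have source $\pi_0$, target $\pi_1$ and product $g'*g$ defined iff $\pi_1(g)=\pi_0(g')$. An $n$-fold groupoid is a family of sets $(C_\alpha)_{\alpha\subset\{1,\dots,n\}}$ with, for each edge $(\beta,\alpha)$ ($\alpha=\beta\cup\{i\}$, $i\notin\beta$; direction $i$), a groupoid with morphisms $C_\alpha$ and objects $C_\beta$, such that each face gives a double groupoid. It is edge-symmetric if the symmetric group $S_n$ acts by isomorphisms $f_\tau:C\to C^\tau$, where $C^\tau=(C_{\tau(\alpha)})_\alpha$. Definition of $\mathsf{Gsy}^{\mathsf n}_{\mathbf t}U=\mathsf G^{\{n\}}_{t_n}\circ\dots\circ\mathsf G^{\{1\}}_{t_1}U$: for a subset $X$ of a module $E$ and $t\in\mathbb K$, $\mathsf G_tX$ is the groupoid with objects $X$, morphisms $X_t=\{(x,v)\in E^2:x\in X,\ x+tv\in X\}$, $\pi_0(x,v)=x$, $\pi_1(x,v)=x+tv$, unit $(x,0)$, $(x',v')*(x,v)=(x,v+v')$. For (the restriction of) a linear map $L$ with $L(X)\subset X'$, $\mathsf G_tL:X_t\to X'_t$ is $(x,v)\mapsto(Lx,Lv)$. $\mathsf{Gsy}^{\mathsf 1}_{t_1}U=\mathsf G_{t_1}U$; given $\mathsf{Gsy}^{\mathsf{n-1}}_{(t_1,\dots,t_{n-1})}U$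 with vertex sets $X_\alpha$ and structure maps that are restrictions of linear maps, the vertex sets of $\mathsf{Gsy}^{\mathsf n}_{\mathbf t}U$ are $X_\alpha$ at $\alpha$ and $(X_\alpha)_{t_n}$ at $\alpha\cup\{n\}$ ($\alpha\subset\{1,\dots,n-1\}$); edges not involving $n$ keep their structure, edges $(\beta\cup\{n\},\alpha\cup\{n\})$ get the structure maps $\mathsf G_{t_n}L$ ($L$ the structure maps of $(\beta,\alpha)$), and $(\alpha,\alpha\cup\{n\})$ gets the groupoid $\mathsf G_{t_n}X_\alpha$. Coordinates: $(x,v)\in(X_\alpha)_{t_n}$ is written as $(v_\gamma)_{\gamma\subset\alpha\cup\{n\}}$ with $x=(v_\gamma)_{\gamma\subset\alpha}$, $v=(v_{\gamma\cup\{n\}})_{\gamma\subset\alpha}$; $v_0,v_1,v_2,v_{12}$ abbreviate $v_\emptyset,v_{\{1\}},v_{\{2\}},v_{\{1,2\}}$. *)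

theory Defs
  imports "HOL-Algebra.Module" "HOL-Combinatorics.Permutations"
begin

section \<open>Groupoids\<close>

text \<open>All structure maps are total HOL functions; only their values on the indicated sets matter.
  \<open>gcomp G g' g\<close> is the product \<open>g' * g\<close>, meaningful iff the target of \<open>g\<close> is the source of \<open>g'\<close>.\<close>

record ('o, 'm) gpd =
  gobj :: "'o set"
  gmor :: "'m set"
  gsrc :: "'m \<Rightarrow> 'o"
  gtgt :: "'m \<Rightarrow> 'o"
  gunit :: "'o \<Rightarrow> 'm"
  gcomp :: "'m \<Rightarrow> 'm \<Rightarrow> 'm"

definition composable :: "('o, 'm) gpd \<Rightarrow> 'm \<Rightarrow> 'm \<Rightarrow> bool" where
  "composable G g' g \<longleftrightarrow> g' \<in> gmor G \<and> g \<in> gmor G \<and> gtgt G g = gsrc G g'"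

definition groupoid :: "('o, 'm) gpd \<Rightarrow> bool" where
  "groupoid G \<longleftrightarrow>
     gsrc G \<in> gmor G \<rightarrow> gobj G \<and> gtgt G \<in> gmor G \<rightarrow> gobj G \<and> gunit G \<in> gobj G \<rightarrow> gmor G \<and>
     (\<forall>x\<in>gobj G. gsrc G (gunit G x) = x \<and> gtgt G (gunit G x) = x) \<and>
     (\<forall>g' g. composable G g' g \<longrightarrow>
        gcomp G g' g \<in> gmor G \<and> gsrc G (gcomp G g' g) = gsrc G g \<and> gtgt G (gcomp G g' g) = gtgt G g') \<and>
     (\<forall>g\<in>gmor G. gcomp G g (gunit G (gsrc G g)) = g \<and> gcomp G (gunit G (gtgt G g)) g = g) \<and>
     (\<forall>g'' g' g. composable G g'' g' \<and> composable G g' g \<longrightarrow>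
        gcomp G g'' (gcomp G g' g) = gcomp G (gcomp G g'' g') g) \<and>
     (\<forall>g\<in>gmor G. \<exists>h\<in>gmor G. gsrc G h = gtgt G g \<and> gtgt G h = gsrc G g \<and>
        gcomp G h g = gunit G (gsrc G g) \<and> gcomp G g h = gunit G (gtgt G g))"

definition gpd_hom ::
  "('o, 'm) gpd \<Rightarrow> ('p, 'n) gpd \<Rightarrow> ('o \<Rightarrow> 'p) \<Rightarrow> ('m \<Rightarrow> 'n) \<Rightarrow> bool" where
  "gpd_hom G H fo fm \<longleftrightarrow>
     fo \<in> gobj G \<rightarrow> gobj H \<and> fm \<in> gmor G \<rightarrow> gmor H \<and>
     (\<forall>g\<in>gmor G. gsrc H (fm g) = fo (gsrc G g) \<and> gtgt H (fm g) = fo (gtgt G g)) \<and>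
     (\<forall>x\<in>gobj G. gunit H (fo x) = fm (gunit G x)) \<and>
     (\<forall>g' g. composable G g' g \<longrightarrow> fm (gcomp G g' g) = gcomp H (fm g') (fm g))"

definition gpd_iso ::
  "('o, 'm) gpd \<Rightarrow> ('p, 'n) gpd \<Rightarrow> ('o \<Rightarrow> 'p) \<Rightarrow> ('m \<Rightarrow> 'n) \<Rightarrow> bool" where
  "gpd_iso G H fo fm \<longleftrightarrow>
     gpd_hom G H fo fm \<and> bij_betw fo (gobj G) (gobj H) \<and> bij_betw fm (gmor G) (gmor H)"

text \<open>A square of groupoids
  \<open>H1 : C12 to C2\<close>, \<open>H0 : C1 to C0\<close> (one direction) and \<open>V1 : C12 to C1\<close>, \<open>V0 : C2 to C0\<close> (the other).
  The structure maps of each direction are functors for the other one; for the product this is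
  the interchange law.\<close>

definition double_groupoid ::
  "('a, 'a) gpd \<Rightarrow> ('a, 'a) gpd \<Rightarrow> ('a, 'a) gpd \<Rightarrow> ('a, 'a) gpd \<Rightarrow> bool" where
  "double_groupoid H0 H1 V0 V1 \<longleftrightarrow>
     groupoid H0 \<and> groupoid H1 \<and> groupoid V0 \<and> groupoid V1 \<and>
     gobj H0 = gobj V0 \<and> gmor H0 = gobj V1 \<and> gmor V0 = gobj H1 \<and> gmor H1 = gmor V1 \<and>
     gpd_hom H1 H0 (gsrc V0) (gsrc V1) \<and> gpd_hom H1 H0 (gtgt V0) (gtgt V1) \<and>
     gpd_hom H0 H1 (gunit V0) (gunit V1) \<and>
     gpd_hom V1 V0 (gsrc H0) (gsrc H1) \<and> gpd_hom V1 V0 (gtgt H0) (gtgt H1) \<and>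
     gpd_hom V0 V1 (gunit H0) (gunit H1) \<and>
     (\<forall>a b c d. composable H1 a b \<and> composable H1 c d \<and> composable V1 a c \<and> composable V1 b d \<longrightarrow>
        gcomp V1 (gcomp H1 a b) (gcomp H1 c d) = gcomp H1 (gcomp V1 a c) (gcomp V1 b d))"

section \<open>\<open>n\<close>-fold groupoids\<close>

text \<open>\<open>edge C \<beta> \<alpha>\<close> is the groupoid of the edge \<open>(\<beta>, \<alpha>)\<close>, with morphisms \<open>vert C \<alpha>\<close> and objects
  \<open>vert C \<beta>\<close>. Only vertices \<open>\<alpha> \<subseteq> {1..n}\<close> and edges \<open>\<alpha> = insert i \<beta>\<close>, \<open>i \<in> {1..n} - \<beta>\<close>, matter.\<close>

record 'a nfold =
  vert :: "nat set \<Rightarrow> 'a set"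
  edge :: "nat set \<Rightarrow> nat set \<Rightarrow> ('a, 'a) gpd"

definition nfold_groupoid :: "nat \<Rightarrow> 'a nfold \<Rightarrow> bool" where
  "nfold_groupoid n C \<longleftrightarrow>
     (\<forall>\<beta> i. \<beta> \<subseteq> {1..n} \<and> i \<in> {1..n} - \<beta> \<longrightarrow>
        groupoid (edge C \<beta> (insert i \<beta>)) \<and>
        gobj (edge C \<beta> (insert i \<beta>)) = vert C \<beta> \<and>
        gmor (edge C \<beta> (insert i \<beta>)) = vert C (insert i \<beta>)) \<and>
     (\<forall>\<beta> i j. \<beta> \<subseteq> {1..n} \<and> i \<in> {1..n} - \<beta> \<and> j \<in> {1..n} - \<beta> \<and> i \<noteq> j \<longrightarrow>
        double_groupoid
          (edge C \<beta> (insert i \<beta>)) (edge C (insert j \<beta>) (insert i (insert j \<beta>)))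
          (edge C \<beta> (insert j \<beta>)) (edge C (insert i \<beta>) (insert i (insert j \<beta>))))"

definition nfold_iso ::
  "nat \<Rightarrow> 'a nfold \<Rightarrow> 'b nfold \<Rightarrow> (nat set \<Rightarrow> 'a \<Rightarrow> 'b) \<Rightarrow> bool" where
  "nfold_iso n C D F \<longleftrightarrow>
     (\<forall>\<alpha>. \<alpha> \<subseteq> {1..n} \<longrightarrow> bij_betw (F \<alpha>) (vert C \<alpha>) (vert D \<alpha>)) \<and>
     (\<forall>\<beta> i. \<beta> \<subseteq> {1..n} \<and> i \<in> {1..n} - \<beta> \<longrightarrow>
        gpd_iso (edge C \<beta> (insert i \<beta>)) (edge D \<beta> (insert i \<beta>)) (F \<beta>) (F (insert i \<beta>)))"

text \<open>\<open>C\<close> with directions permuted: \<open>(C\<^bsub>\<tau>(\<alpha>)\<^esub>)\<^sub>\<alpha>\<close>.\<close>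

definition nfold_perm :: "(nat \<Rightarrow> nat) \<Rightarrow> 'a nfold \<Rightarrow> 'a nfold" where
  "nfold_perm \<tau> C = \<lparr>vert = (\<lambda>\<alpha>. vert C (\<tau> ` \<alpha>)), edge = (\<lambda>\<beta> \<alpha>. edge C (\<tau> ` \<beta>) (\<tau> ` \<alpha>))\<rparr>"

text \<open>\<open>f \<tau> \<alpha>\<close> maps \<open>C\<^sub>\<alpha>\<close> to \<open>C\<^bsub>\<tau>(\<alpha>)\<^esub>\<close>, which accounts for the shape of the action law.\<close>

definition edge_symmetric :: "nat \<Rightarrow> 'a nfold \<Rightarrow> bool" where
  "edge_symmetric n C \<longleftrightarrow> nfold_groupoid n C \<and>
     (\<exists>f :: (nat \<Rightarrow> nat) \<Rightarrow> nat set \<Rightarrow> 'a \<Rightarrow> 'a.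
        (\<forall>\<tau>. \<tau> permutes {1..n} \<longrightarrow> nfold_iso n C (nfold_perm \<tau> C) (f \<tau>)) \<and>
        (\<forall>\<alpha>. \<alpha> \<subseteq> {1..n} \<longrightarrow> (\<forall>v\<in>vert C \<alpha>. f id \<alpha> v = v)) \<and>
        (\<forall>\<sigma> \<tau> \<alpha>. \<sigma> permutes {1..n} \<and> \<tau> permutes {1..n} \<and> \<alpha> \<subseteq> {1..n} \<longrightarrow>
           (\<forall>v\<in>vert C \<alpha>. f (\<sigma> \<circ> \<tau>) \<alpha> v = f \<sigma> (\<tau> ` \<alpha>) (f \<tau> \<alpha> v))))"

definition gpd_prod ::
  "('o, 'm) gpd \<Rightarrow> ('p, 'n) gpd \<Rightarrow> ('o \<times> 'p, 'm \<times> 'n) gpd" where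
  "gpd_prod G H = \<lparr>gobj = gobj G \<times> gobj H, gmor = gmor G \<times> gmor H,
     gsrc = map_prod (gsrc G) (gsrc H), gtgt = map_prod (gtgt G) (gtgt H),
     gunit = map_prod (gunit G) (gunit H),
     gcomp = (\<lambda>(g', h') (g, h). (gcomp G g' g, gcomp H h' h))\<rparr>"

definition nfold_prod :: "'a nfold \<Rightarrow> 'b nfold \<Rightarrow> ('a \<times> 'b) nfold" where
  "nfold_prod C D = \<lparr>vert = (\<lambda>\<alpha>. vert C \<alpha> \<times> vert D \<alpha>),
     edge = (\<lambda>\<beta> \<alpha>. gpd_prod (edge C \<beta> \<alpha>) (edge D \<beta> \<alpha>))\<rparr>"

section \<open>Linear sets\<close>

definition linear_set :: "('k, 'r) ring_scheme \<Rightarrow> ('k, 'v, 'z) module_scheme \<Rightarrow> 'v set \<Rightarrow> bool" where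
  "linear_set K V U \<longleftrightarrow> module K V \<and> U \<subseteq> carrier V"

definition linear_set_hom ::
  "('k, 'r) ring_scheme \<Rightarrow> ('k, 'v, 'y) module_scheme \<Rightarrow> 'v set \<Rightarrow>
   ('k, 'w, 'z) module_scheme \<Rightarrow> 'w set \<Rightarrow> ('v \<Rightarrow> 'w) \<Rightarrow> bool" where
  "linear_set_hom K V U W U' f \<longleftrightarrow>
     f \<in> carrier V \<rightarrow> carrier W \<and>
     (\<forall>x\<in>carrier V. \<forall>y\<in>carrier V. f (x \<oplus>\<^bsub>V\<^esub> y) = f x \<oplus>\<^bsub>W\<^esub> f y) \<and>
     (\<forall>a\<in>carrier K. \<forall>x\<in>carrier V. f (a \<odot>\<^bsub>V\<^esub> x) = a \<odot>\<^bsub>W\<^esub> f x) \<and>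
     f ` U \<subseteq> U'"

text \<open>HOL-Algebra module records extend ring records; the fields \<open>mult\<close> and \<open>one\<close> of a module are
  meaningless and left undefined below.\<close>

definition module_prod ::
  "('k, 'v, 'y) module_scheme \<Rightarrow> ('k, 'w, 'z) module_scheme \<Rightarrow> ('k, 'v \<times> 'w) module" where
  "module_prod V W = \<lparr>carrier = carrier V \<times> carrier W, monoid.mult = undefined, one = undefined,
     zero = (\<zero>\<^bsub>V\<^esub>, \<zero>\<^bsub>W\<^esub>), add = (\<lambda>(x, y) (x', y'). (x \<oplus>\<^bsub>V\<^esub> x', y \<oplus>\<^bsub>W\<^esub> y')),
     smult = (\<lambda>a (x, y). (a \<odot>\<^bsub>V\<^esub> x, a \<odot>\<^bsub>W\<^esub> y))\<rparr>"

text \<open>The module of families \<open>(v\<^sub>\<gamma>)\<close> in \<open>V\<close> indexed by \<open>\<gamma> \<subseteq> \<alpha>\<close>. Families are functions on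
  \<open>nat set\<close> that are \<open>undefined\<close> outside \<open>Pow \<alpha>\<close>.\<close>

definition fam_module ::
  "('k, 'v, 'z) module_scheme \<Rightarrow> nat set \<Rightarrow> ('k, nat set \<Rightarrow> 'v) module" where
  "fam_module V \<alpha> = \<lparr>carrier = Pow \<alpha> \<rightarrow>\<^sub>E carrier V, monoid.mult = undefined, one = undefined,
     zero = (\<lambda>\<gamma>\<in>Pow \<alpha>. \<zero>\<^bsub>V\<^esub>), add = (\<lambda>v w. \<lambda>\<gamma>\<in>Pow \<alpha>. v \<gamma> \<oplus>\<^bsub>V\<^esub> w \<gamma>),
     smult = (\<lambda>a v. \<lambda>\<gamma>\<in>Pow \<alpha>. a \<odot>\<^bsub>V\<^esub> v \<gamma>)\<rparr>"

section \<open>The functor \<open>G\<^sub>t\<close>\<close>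

definition G_set :: "('k, 'e, 'z) module_scheme \<Rightarrow> 'k \<Rightarrow> 'e set \<Rightarrow> ('e \<times> 'e) set" where
  "G_set E t X = {(x, v) \<in> carrier E \<times> carrier E. x \<in> X \<and> x \<oplus>\<^bsub>E\<^esub> t \<odot>\<^bsub>E\<^esub> v \<in> X}"

definition G_gpd :: "('k, 'e, 'z) module_scheme \<Rightarrow> 'k \<Rightarrow> 'e set \<Rightarrow> ('e, 'e \<times> 'e) gpd" where
  "G_gpd E t X = \<lparr>gobj = X, gmor = G_set E t X,
     gsrc = (\<lambda>(x, v). x), gtgt = (\<lambda>(x, v). x \<oplus>\<^bsub>E\<^esub> t \<odot>\<^bsub>E\<^esub> v),
     gunit = (\<lambda>x. (x, \<zero>\<^bsub>E\<^esub>)),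
     gcomp = (\<lambda>(x', v') (x, v). (x, v \<oplus>\<^bsub>E\<^esub> v'))\<rparr>"

definition G_map :: "('e \<Rightarrow> 'f) \<Rightarrow> 'e \<times> 'e \<Rightarrow> 'f \<times> 'f" where
  "G_map L = (\<lambda>(x, v). (L x, L v))"

text \<open>\<open>G\<^sub>t\<close> applied to a groupoid whose objects and morphisms are subsets of modules \<open>E\<close>, \<open>F\<close> and whose
  structure maps are restrictions of linear maps \<open>L\<close>. The record fields hold the linear maps
  themselves, since \<open>G_map L\<close> also evaluates \<open>L\<close> at vectors outside the given subsets. The product is
  a linear map of the pair \<open>(g', g)\<close>; up to exchanging the two middle entries of
  \<open>((x', x), (v', v))\<close>, the last field is \<open>G_map\<close> of it.\<close>

definition G_lift ::
  "('k, 'e, 'y) module_scheme \<Rightarrow> ('k, 'f, 'z) module_scheme \<Rightarrow> 'k \<Rightarrow> ('e, 'f) gpd \<Rightarrow>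
   ('e \<times> 'e, 'f \<times> 'f) gpd" where
  "G_lift E F t G = \<lparr>gobj = G_set E t (gobj G), gmor = G_set F t (gmor G),
     gsrc = G_map (gsrc G), gtgt = G_map (gtgt G), gunit = G_map (gunit G),
     gcomp = (\<lambda>(x', v') (x, v). (gcomp G x' x, gcomp G v' v))\<rparr>"

section \<open>The \<open>n\<close>-fold groupoid \<open>Gsy\<close>\<close>

text \<open>For \<open>m \<notin> \<alpha>\<close>, \<open>join m \<alpha>\<close> writes a pair of families over \<open>Pow \<alpha>\<close> as one family over
  \<open>Pow (insert m \<alpha>)\<close>; \<open>unjoin m \<alpha>\<close> is the inverse.\<close>

definition join :: "nat \<Rightarrow> nat set \<Rightarrow> (nat set \<Rightarrow> 'v) \<times> (nat set \<Rightarrow> 'v) \<Rightarrow> nat set \<Rightarrow> 'v" where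
  "join m \<alpha> = (\<lambda>(x, v). \<lambda>\<gamma>\<in>Pow (insert m \<alpha>). if m \<in> \<gamma> then v (\<gamma> - {m}) else x \<gamma>)"

definition unjoin :: "nat \<Rightarrow> nat set \<Rightarrow> (nat set \<Rightarrow> 'v) \<Rightarrow> (nat set \<Rightarrow> 'v) \<times> (nat set \<Rightarrow> 'v)" where
  "unjoin m \<alpha> w = (\<lambda>\<gamma>\<in>Pow \<alpha>. w \<gamma>, \<lambda>\<gamma>\<in>Pow \<alpha>. w (insert m \<gamma>))"

text \<open>Transport of structure along \<open>p\<close> (objects) and \<open>q\<close> (morphisms) with inverses \<open>p'\<close>, \<open>q'\<close>.\<close>

definition gpd_transport ::
  "('o \<Rightarrow> 'p) \<Rightarrow> ('p \<Rightarrow> 'o) \<Rightarrow> ('m \<Rightarrow> 'n) \<Rightarrow> ('n \<Rightarrow> 'm) \<Rightarrow> ('o, 'm) gpd \<Rightarrow> ('p, 'n) gpd" where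
  "gpd_transport p p' q q' G = \<lparr>gobj = p ` gobj G, gmor = q ` gmor G,
     gsrc = p \<circ> gsrc G \<circ> q', gtgt = p \<circ> gtgt G \<circ> q', gunit = q \<circ> gunit G \<circ> p',
     gcomp = (\<lambda>h' h. q (gcomp G (q' h') (q' h)))\<rparr>"

text \<open>\<open>U\<close> is identified with the set of families \<open>(v\<^sub>\<emptyset>)\<close>.\<close>

definition pt :: "'v \<Rightarrow> nat set \<Rightarrow> 'v" where
  "pt u = (\<lambda>\<gamma>\<in>Pow {}. u)"

text \<open>The recursion starts at \<open>n = 0\<close> with the set \<open>U\<close> (no edges), so that its first step is
  \<open>G\<close> with parameter \<open>t 1\<close> applied to \<open>U\<close>. The entries of the sequence \<open>t\<close> beyond \<open>n\<close> are not used.\<close>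

primrec Gsy :: "('k, 'v, 'z) module_scheme \<Rightarrow> (nat \<Rightarrow> 'k) \<Rightarrow> 'v set \<Rightarrow> nat \<Rightarrow> (nat set \<Rightarrow> 'v) nfold" where
  "Gsy V t U 0 = \<lparr>vert = (\<lambda>\<alpha>. pt ` U), edge = undefined\<rparr>"
| "Gsy V t U (Suc n) = (let C = Gsy V t U n; m = Suc n in
     \<lparr>vert = (\<lambda>\<alpha>.
        if m \<in> \<alpha> then join m (\<alpha> - {m}) ` G_set (fam_module V (\<alpha> - {m})) (t m) (vert C (\<alpha> - {m}))
        else vert C \<alpha>),
      edge = (\<lambda>\<beta> \<alpha>.
        if m \<notin> \<alpha> then edge C \<beta> \<alpha>
        else if m \<in> \<beta> then
          gpd_transport (join m (\<beta> - {m})) (unjoin m (\<beta> - {m})) (join m (\<alpha> - {m})) (unjoin m (\<alpha> - {m}))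
            (G_lift (fam_module V (\<beta> - {m})) (fam_module V (\<alpha> - {m})) (t m)
               (edge C (\<beta> - {m}) (\<alpha> - {m})))
        else
          gpd_transport id id (join m \<beta>) (unjoin m \<beta>) (G_gpd (fam_module V \<beta>) (t m) (vert C \<beta>)))\<rparr>)"

text \<open>\<open>Gsy\<close> on a morphism \<open>f\<close> of linear sets, obtained by iterating \<open>G_map\<close> in the same way;
  \<open>Gsy_map f n \<alpha>\<close> is its component at the vertex \<open>\<alpha>\<close>.\<close>

primrec Gsy_map :: "('v \<Rightarrow> 'w) \<Rightarrow> nat \<Rightarrow> nat set \<Rightarrow> (nat set \<Rightarrow> 'v) \<Rightarrow> (nat set \<Rightarrow> 'w)" where
  "Gsy_map f 0 = (\<lambda>\<alpha> v. pt (f (v {})))"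
| "Gsy_map f (Suc n) = (\<lambda>\<alpha>.
     if Suc n \<in> \<alpha> then
       join (Suc n) (\<alpha> - {Suc n}) \<circ> G_map (Gsy_map f n (\<alpha> - {Suc n})) \<circ> unjoin (Suc n) (\<alpha> - {Suc n})
     else Gsy_map f n \<alpha>)"

section \<open>Notation for the structure theorem\<close>

definition tdot ::
  "('k, 'r) ring_scheme \<Rightarrow> ('k, 'v, 'z) module_scheme \<Rightarrow> (nat \<Rightarrow> 'k) \<Rightarrow> nat set \<Rightarrow> 'v \<Rightarrow> 'v" where
  "tdot K V t \<gamma> v = (\<Otimes>\<^bsub>K\<^esub>i\<in>\<gamma>. t i) \<odot>\<^bsub>V\<^esub> v"

definition xsum ::
  "('k, 'r) ring_scheme \<Rightarrow> ('k, 'v, 'z) module_scheme \<Rightarrow> (nat \<Rightarrow> 'k) \<Rightarrow> nat set \<Rightarrow>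
   (nat set \<Rightarrow> 'v) \<Rightarrow> 'v" where
  "xsum K V t \<beta> v = (\<Oplus>\<^bsub>V\<^esub>\<gamma>\<in>Pow \<beta>. tdot K V t \<gamma> (v \<gamma>))"

text \<open>The composite of the projections from the vertex \<open>\<alpha>\<close> down along the path that removes the
  directions in the list one after the other, using the target in directions \<open>i \<in> \<beta>\<close> and the source
  in all others.\<close>

primrec topdown :: "'a nfold \<Rightarrow> nat set \<Rightarrow> nat set \<Rightarrow> nat list \<Rightarrow> 'a \<Rightarrow> 'a" where
  "topdown C \<beta> \<alpha> [] = id"
| "topdown C \<beta> \<alpha> (i # ds) =
     topdown C \<beta> (\<alpha> - {i}) ds \<circ> (if i \<in> \<beta> then gtgt else gsrc) (edge C (\<alpha> - {i}) \<alpha>)"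

definition params2 :: "'k \<Rightarrow> 'k \<Rightarrow> nat \<Rightarrow> 'k" where
  "params2 a b = (\<lambda>i. if i = 1 then a else b)"

text \<open>Componentwise flip \<open>(v\<^sub>0, v\<^sub>1, v\<^sub>2, v\<^sub>1\<^sub>2)\<close> to \<open>(v\<^sub>0, v\<^sub>2, v\<^sub>1, v\<^sub>1\<^sub>2)\<close>; at \<open>\<alpha> \<noteq> {1, 2}\<close> the entries present.\<close>

definition flip :: "nat set \<Rightarrow> (nat set \<Rightarrow> 'v) \<Rightarrow> (nat set \<Rightarrow> 'v)" where
  "flip \<alpha> v = (\<lambda>\<gamma>\<in>Pow \<alpha>. if \<gamma> = {1} then v {2} else if \<gamma> = {2} then v {1} else v \<gamma>)"

definition unzip :: "nat set \<Rightarrow> (nat set \<Rightarrow> 'v \<times> 'w) \<Rightarrow> (nat set \<Rightarrow> 'v) \<times> (nat set \<Rightarrow> 'w)" where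
  "unzip \<alpha> z = (\<lambda>\<gamma>\<in>Pow \<alpha>. fst (z \<gamma>), \<lambda>\<gamma>\<in>Pow \<alpha>. snd (z \<gamma>))"

end

theory Submission
  imports Defs
begin

text \<open>The vertex sets satisfy a one-step recursion: a family over \<open>\<alpha> = \<beta> \<union> {i}\<close> belongs to
  \<open>U\<^bsub>t\<^esub>\<^bsup>\<alpha>\<^esup>\<close> iff its source and its target in direction \<open>i\<close> belong to \<open>U\<^bsub>t\<^esub>\<^bsup>\<beta>\<^esup>\<close>, because
  splitting the subsets of \<open>\<alpha>\<close> according to whether they contain \<open>i\<close> turns \<open>x\<^bsub>\<gamma> \<union> {i}\<^esub>\<close> into \<open>x\<^bsub>\<gamma>\<^esub>\<close>
  of the target. The condition is symmetric in the directions, whereas the construction adds them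
  one at a time; so the recursion identifies the vertex and edge data of \<open>Gsy\<close> by
  induction on \<open>n\<close>, and it reduces all further membership questions (units, products, inverses, permutations
  of directions, pairs) to componentwise identities for sources and targets.\<close>

section \<open>Families and their projections\<close>

text \<open>Two kinds of edges come out of the construction: the newest direction is a groupoid
  \<open>G_gpd\<close>, the older ones are lifts of earlier edges. The predicate
  \<open>fam_edge\<close> forgets this difference. Once every edge satisfies it, no direction is
  distinguished, and half of the double groupoid conditions follow from the other half by exchanging
  two directions. The formulas are total operations on families. The product reads only those
  entries of its left factor whose index contains the direction, so associativity, unit laws and
  interchange are entrywise identities of arbitrary families; composability matters for the target
  of a product, hence for its membership in the vertex set. Since families are
  \<open>undefined\<close> off their index set, entrywise equality on that set is equality of
  functions. Index sets stay inside \<open>{1..n}\<close>, which makes them finite and puts all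
  parameters in \<open>carrier K\<close>, as the sums and products over subsets require.\<close>

abbreviation (input) fam :: "('k, 'v, 'z) module_scheme \<Rightarrow> nat set \<Rightarrow> (nat set \<Rightarrow> 'v) set" where
  "fam V \<alpha> \<equiv> Pow \<alpha> \<rightarrow>\<^sub>E carrier V"

definition fsrc :: "nat set \<Rightarrow> (nat set \<Rightarrow> 'v) \<Rightarrow> nat set \<Rightarrow> 'v" where
  "fsrc \<beta> v = (\<lambda>\<gamma>\<in>Pow \<beta>. v \<gamma>)"

definition ftgt :: "('k, 'v, 'z) module_scheme \<Rightarrow> 'k \<Rightarrow> nat \<Rightarrow> nat set \<Rightarrow> (nat set \<Rightarrow> 'v) \<Rightarrow> nat set \<Rightarrow> 'v" where
  "ftgt V a i \<beta> v = (\<lambda>\<gamma>\<in>Pow \<beta>. v \<gamma> \<oplus>\<^bsub>V\<^esub> a \<odot>\<^bsub>V\<^esub> v (insert i \<gamma>))"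

definition funit :: "('k, 'v, 'z) module_scheme \<Rightarrow> nat \<Rightarrow> nat set \<Rightarrow> (nat set \<Rightarrow> 'v) \<Rightarrow> nat set \<Rightarrow> 'v" where
  "funit V i \<beta> v = (\<lambda>\<gamma>\<in>Pow (insert i \<beta>). if i \<in> \<gamma> then \<zero>\<^bsub>V\<^esub> else v \<gamma>)"

text \<open>The argument order is that of \<open>gcomp\<close>: \<open>w\<close> comes after
  \<open>v\<close>. The entries of \<open>w\<close> at indices without \<open>i\<close> form its
  source; they are dropped, since for a composable pair \<open>v\<close> determines them.\<close>

definition fmul :: "('k, 'v, 'z) module_scheme \<Rightarrow> nat \<Rightarrow> nat set \<Rightarrow>
    (nat set \<Rightarrow> 'v) \<Rightarrow> (nat set \<Rightarrow> 'v) \<Rightarrow> nat set \<Rightarrow> 'v" where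
  "fmul V i \<beta> w v = (\<lambda>\<gamma>\<in>Pow (insert i \<beta>). if i \<in> \<gamma> then v \<gamma> \<oplus>\<^bsub>V\<^esub> w \<gamma> else v \<gamma>)"

text \<open>Witness for the existence of inverses: the base point moves to the target of
  \<open>v\<close>, and the tangent entries change sign.\<close>

definition finv :: "('k, 'v, 'z) module_scheme \<Rightarrow> 'k \<Rightarrow> nat \<Rightarrow> nat set \<Rightarrow> (nat set \<Rightarrow> 'v) \<Rightarrow> nat set \<Rightarrow> 'v" where
  "finv V a i \<beta> v = (\<lambda>\<gamma>\<in>Pow (insert i \<beta>).
     if i \<in> \<gamma> then \<ominus>\<^bsub>V\<^esub> v \<gamma> else v \<gamma> \<oplus>\<^bsub>V\<^esub> a \<odot>\<^bsub>V\<^esub> v (insert i \<gamma>))"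

definition vset :: "('k, 'r) ring_scheme \<Rightarrow> ('k, 'v, 'z) module_scheme \<Rightarrow> (nat \<Rightarrow> 'k) \<Rightarrow> 'v set \<Rightarrow>
    nat set \<Rightarrow> (nat set \<Rightarrow> 'v) set" where
  "vset K V t U \<alpha> = {v \<in> fam V \<alpha>. \<forall>\<beta>. \<beta> \<subseteq> \<alpha> \<longrightarrow> xsum K V t \<beta> v \<in> U}"

text \<open>The formulas are required on all families, not only on the vertex sets: a lifted edge
  (\<open>G_lift\<close>) also evaluates its structure maps at tangent vectors, which need not be vertices.\<close>

definition fam_edge :: "('k, 'r) ring_scheme \<Rightarrow> ('k, 'v, 'z) module_scheme \<Rightarrow> (nat \<Rightarrow> 'k) \<Rightarrow> 'v set \<Rightarrow>
    nat \<Rightarrow> nat set \<Rightarrow> (nat set \<Rightarrow> 'v, nat set \<Rightarrow> 'v) gpd \<Rightarrow> bool" where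
  "fam_edge K V t U i \<beta> G \<longleftrightarrow>
     gobj G = vset K V t U \<beta> \<and> gmor G = vset K V t U (insert i \<beta>) \<and>
     (\<forall>v\<in>fam V (insert i \<beta>). gsrc G v = fsrc \<beta> v \<and> gtgt G v = ftgt V (t i) i \<beta> v) \<and>
     (\<forall>v\<in>fam V \<beta>. gunit G v = funit V i \<beta> v) \<and>
     (\<forall>w\<in>fam V (insert i \<beta>). \<forall>v\<in>fam V (insert i \<beta>). gcomp G w v = fmul V i \<beta> w v)"

locale gsy_data = module K V for K :: "('k, 'r) ring_scheme" (structure)
    and V :: "('k, 'v, 'z) module_scheme" (structure) +
  fixes t :: "nat \<Rightarrow> 'k" and U :: "'v set" and n :: nat
  assumes U_sub: "U \<subseteq> carrier V"
    and t_closed: "i \<in> {1..n} \<Longrightarrow> t i \<in> carrier K"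
begin

lemma fam_mem: "v \<in> fam V \<alpha> \<Longrightarrow> \<gamma> \<subseteq> \<alpha> \<Longrightarrow> v \<gamma> \<in> carrier V"
  by auto

lemma fsrc_fam: "v \<in> fam V (insert i \<beta>) \<Longrightarrow> fsrc \<beta> v \<in> fam V \<beta>"
  by (auto simp: fsrc_def fam_mem)

lemma ftgt_fam: "v \<in> fam V (insert i \<beta>) \<Longrightarrow> a \<in> carrier K \<Longrightarrow> ftgt V a i \<beta> v \<in> fam V \<beta>"
  by (auto simp: ftgt_def fam_mem)

lemma funit_fam: "v \<in> fam V \<beta> \<Longrightarrow> funit V i \<beta> v \<in> fam V (insert i \<beta>)"
  by (auto simp: funit_def fam_mem subset_insert)

lemma fmul_fam: "v \<in> fam V (insert i \<beta>) \<Longrightarrow> w \<in> fam V (insert i \<beta>) \<Longrightarrow> fmul V i \<beta> w v \<in> fam V (insert i \<beta>)"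
  by (auto simp: fmul_def fam_mem)

lemma finv_fam: "v \<in> fam V (insert i \<beta>) \<Longrightarrow> a \<in> carrier K \<Longrightarrow> finv V a i \<beta> v \<in> fam V (insert i \<beta>)"
  by (auto simp: finv_def fam_mem)

section \<open>Weighted sums over subsets and the recursion for vertex sets\<close>

lemma prod_closed: "\<gamma> \<subseteq> {1..n} \<Longrightarrow> (\<Otimes>\<^bsub>K\<^esub>i\<in>\<gamma>. t i) \<in> carrier K"
  by (rule R.finprod_closed) (use t_closed in auto)

lemma tdot_closed: "\<gamma> \<subseteq> {1..n} \<Longrightarrow> x \<in> carrier V \<Longrightarrow> tdot K V t \<gamma> x \<in> carrier V"
  by (simp add: tdot_def prod_closed)

lemma xsum_cong:
  assumes "\<beta> \<subseteq> {1..n}" "\<And>\<gamma>. \<gamma> \<subseteq> \<beta> \<Longrightarrow> v \<gamma> = w \<gamma>" "\<And>\<gamma>. \<gamma> \<subseteq> \<beta> \<Longrightarrow> w \<gamma> \<in> carrier V"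
  shows "xsum K V t \<beta> v = xsum K V t \<beta> w"
  unfolding xsum_def
  by (rule M.finsum_cong') (use assms in \<open>auto intro!: tdot_closed\<close>)

lemma xsum_empty: "v {} \<in> carrier V \<Longrightarrow> xsum K V t {} v = v {}"
  by (simp add: xsum_def tdot_def)

lemma xsum_insert:
  assumes sub: "insert i \<beta> \<subseteq> {1..n}" and i: "i \<notin> \<beta>"
    and v: "\<And>\<gamma>. \<gamma> \<subseteq> insert i \<beta> \<Longrightarrow> v \<gamma> \<in> carrier V"
  shows "xsum K V t (insert i \<beta>) v = xsum K V t \<beta> (ftgt V (t i) i \<beta> v)"
proof -
  have fin: "finite \<beta>" using sub finite_subset[of \<beta> "{1..n}"] by auto
  have ti: "t i \<in> carrier K" using sub t_closed by auto
  have inj: "inj_on (insert i) (Pow \<beta>)"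
    using i by (auto simp: inj_on_def)
  have v': "v \<gamma> \<in> carrier V" "v (insert i \<gamma>) \<in> carrier V" if "\<gamma> \<subseteq> \<beta>" for \<gamma>
    using that by (auto intro!: v)
  have cl: "tdot K V t \<gamma> (v \<gamma>) \<in> carrier V" if "\<gamma> \<subseteq> insert i \<beta>" for \<gamma>
    using that sub v by (intro tdot_closed) auto
  have cl': "tdot K V t (insert i \<gamma>) (v (insert i \<gamma>)) \<in> carrier V" if "\<gamma> \<subseteq> \<beta>" for \<gamma>
    using that by (intro cl) auto
  have "xsum K V t (insert i \<beta>) v
      = (\<Oplus>\<^bsub>V\<^esub>\<gamma>\<in>Pow \<beta>. tdot K V t \<gamma> (v \<gamma>)) \<oplus>\<^bsub>V\<^esub> (\<Oplus>\<^bsub>V\<^esub>\<gamma>\<in>insert i ` Pow \<beta>. tdot K V t \<gamma> (v \<gamma>))"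
    unfolding xsum_def Pow_insert
    by (rule M.finsum_Un_disjoint) (use fin i cl cl' in auto)
  also have "(\<Oplus>\<^bsub>V\<^esub>\<gamma>\<in>insert i ` Pow \<beta>. tdot K V t \<gamma> (v \<gamma>))
      = (\<Oplus>\<^bsub>V\<^esub>\<gamma>\<in>Pow \<beta>. tdot K V t (insert i \<gamma>) (v (insert i \<gamma>)))"
    by (rule M.finsum_reindex) (use inj cl' in auto)
  also have "(\<Oplus>\<^bsub>V\<^esub>\<gamma>\<in>Pow \<beta>. tdot K V t \<gamma> (v \<gamma>)) \<oplus>\<^bsub>V\<^esub> \<dots>
      = (\<Oplus>\<^bsub>V\<^esub>\<gamma>\<in>Pow \<beta>. tdot K V t \<gamma> (v \<gamma>) \<oplus>\<^bsub>V\<^esub> tdot K V t (insert i \<gamma>) (v (insert i \<gamma>)))"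
    by (rule M.finsum_addf [symmetric]) (use cl cl' in auto)
  also have "\<dots> = xsum K V t \<beta> (ftgt V (t i) i \<beta> v)"
    unfolding xsum_def
  proof (rule M.finsum_cong')
    show "(\<lambda>\<gamma>. tdot K V t \<gamma> (ftgt V (t i) i \<beta> v \<gamma>)) \<in> Pow \<beta> \<rightarrow> carrier V"
    proof
      fix \<gamma> assume "\<gamma> \<in> Pow \<beta>"
      then have "\<gamma> \<subseteq> \<beta>" by simp
      with sub ti v'[of \<gamma>] show "tdot K V t \<gamma> (ftgt V (t i) i \<beta> v \<gamma>) \<in> carrier V"
        by (intro tdot_closed) (auto simp: ftgt_def)
    qed
    fix \<gamma> assume "\<gamma> \<in> Pow \<beta>"
    then have sb: "\<gamma> \<subseteq> \<beta>" by simp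
    then have g: "i \<notin> \<gamma>" "finite \<gamma>" "\<gamma> \<subseteq> {1..n}" "v \<gamma> \<in> carrier V" "v (insert i \<gamma>) \<in> carrier V"
      using i sub finite_subset[OF sb fin] v'[OF sb] by auto
    have "(\<Otimes>\<^bsub>K\<^esub>k\<in>insert i \<gamma>. t k) = t i \<otimes>\<^bsub>K\<^esub> (\<Otimes>\<^bsub>K\<^esub>k\<in>\<gamma>. t k)"
      by (rule R.finprod_insert) (use g ti t_closed in auto)
    \<comment> \<open>Commutativity of \<open>K\<close> enters: with \<open>t i\<close> on the right
      of the product, \<open>smult_assoc1\<close> lets it act on the entry first, as it does in
      \<open>ftgt\<close>.\<close>
    also have "\<dots> = (\<Otimes>\<^bsub>K\<^esub>k\<in>\<gamma>. t k) \<otimes>\<^bsub>K\<^esub> t i"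
      using g prod_closed ti R.m_comm by blast
    finally show "tdot K V t \<gamma> (v \<gamma>) \<oplus>\<^bsub>V\<^esub> tdot K V t (insert i \<gamma>) (v (insert i \<gamma>))
        = tdot K V t \<gamma> (ftgt V (t i) i \<beta> v \<gamma>)"
      using sb g ti prod_closed[of \<gamma>] by (simp add: tdot_def ftgt_def smult_r_distr smult_assoc1)
  qed simp
  finally show ?thesis .
qed

lemma xsum_fsrc:
  assumes "\<beta> \<subseteq> {1..n}" "\<gamma> \<subseteq> \<beta>" "v \<in> fam V (insert i \<beta>)"
  shows "xsum K V t \<gamma> (fsrc \<beta> v) = xsum K V t \<gamma> v"
proof (rule xsum_cong)
  show "v \<gamma>' \<in> carrier V" if "\<gamma>' \<subseteq> \<gamma>" for \<gamma>'
    using fam_mem[OF assms(3)] that assms(2) by blast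
qed (use assms in \<open>auto simp: fsrc_def\<close>)

text \<open>\<open>xsum_insert\<close> yields the target cut down to \<open>Pow \<gamma>\<close>. A
  sum over \<open>Pow \<gamma>\<close> reads no other entries, so the target over the larger set
  \<open>\<beta>\<close> may replace it.\<close>

lemma xsum_ftgt:
  assumes "insert i \<beta> \<subseteq> {1..n}" "i \<notin> \<beta>" "\<gamma> \<subseteq> \<beta>" "v \<in> fam V (insert i \<beta>)"
  shows "xsum K V t \<gamma> (ftgt V (t i) i \<beta> v) = xsum K V t (insert i \<gamma>) v"
proof -
  have "xsum K V t (insert i \<gamma>) v = xsum K V t \<gamma> (ftgt V (t i) i \<gamma> v)"
    by (rule xsum_insert) (use assms in \<open>auto intro!: fam_mem[OF assms(4)]\<close>)
  also have "\<dots> = xsum K V t \<gamma> (ftgt V (t i) i \<beta> v)"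
    by (rule xsum_cong) (use assms t_closed in \<open>auto simp: ftgt_def intro!: fam_mem[OF assms(4)] M.add.m_closed smult_closed\<close>)
  finally show ?thesis ..
qed

lemma vset_insert:
  assumes "insert i \<beta> \<subseteq> {1..n}" "i \<notin> \<beta>"
  shows "v \<in> vset K V t U (insert i \<beta>) \<longleftrightarrow>
    v \<in> fam V (insert i \<beta>) \<and> fsrc \<beta> v \<in> vset K V t U \<beta> \<and> ftgt V (t i) i \<beta> v \<in> vset K V t U \<beta>"
proof (cases "v \<in> fam V (insert i \<beta>)")
  case True
  have ti: "t i \<in> carrier K" using assms t_closed by auto
  \<comment> \<open>The conditions of the larger vertex set come in pairs: the one at
    \<open>\<gamma>\<close> is a condition on the source, the one at
    \<open>insert i \<gamma>\<close> a condition on the target.\<close>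
  have "(\<forall>\<gamma>. \<gamma> \<subseteq> insert i \<beta> \<longrightarrow> P \<gamma>) \<longleftrightarrow> (\<forall>\<gamma>. \<gamma> \<subseteq> \<beta> \<longrightarrow> P \<gamma> \<and> P (insert i \<gamma>))" for P
    by (metis insert_mono subset_insert subset_insertI2 subset_insert_iff insert_Diff)
  then show ?thesis
    using True assms fsrc_fam[OF True] ftgt_fam[OF True ti]
    by (simp add: vset_def xsum_fsrc xsum_ftgt) blast
qed (auto simp: vset_def)

lemma vset_fam: "v \<in> vset K V t U \<alpha> \<Longrightarrow> v \<in> fam V \<alpha>"
  by (simp add: vset_def)

text \<open>Start of the recursion: the empty product is 1, so the only sum is the entry at
  \<open>{}\<close>, and a family that is \<open>undefined\<close> elsewhere is \<open>pt\<close> of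
  this entry.\<close>

lemma vset_empty: "vset K V t U {} = pt ` U"
proof (intro Set.set_eqI iffI)
  fix v assume v: "v \<in> vset K V t U {}"
  then have f: "v \<in> fam V {}" and x: "xsum K V t {} v \<in> U" by (simp_all add: vset_def)
  have "xsum K V t {} v = v {}"
    using fam_mem[OF f] by (intro xsum_empty) simp
  moreover have "v = pt (v {})"
  proof
    show "v \<gamma> = pt (v {}) \<gamma>" for \<gamma>
      using PiE_arb[OF f, of \<gamma>] by (cases "\<gamma> = {}") (simp_all add: pt_def)
  qed
  ultimately show "v \<in> pt ` U" using x by (metis imageI)
next
  fix v assume "v \<in> pt ` U"
  then obtain u where u: "u \<in> U" "v = pt u" by blast
  then have "pt u \<in> fam V {}" "pt u {} = u" using U_sub by (auto simp: pt_def)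
  moreover have "xsum K V t {} (pt u) = u"
    using u U_sub \<open>pt u {} = u\<close> xsum_empty[of "pt u"] by auto
  ultimately show "v \<in> vset K V t U {}"
    using u by (simp add: vset_def)
qed

end

section \<open>Vertices and edges of the recursive construction\<close>

lemma fam_eqI:
  assumes "v \<in> fam V \<alpha>" "w \<in> fam V \<alpha>" "\<And>\<gamma>. \<gamma> \<subseteq> \<alpha> \<Longrightarrow> v \<gamma> = w \<gamma>"
  shows "v = w"
  by (rule PiE_ext[OF assms(1,2)]) (use assms(3) in auto)

lemma subset_insert_cases:
  assumes "\<gamma> \<subseteq> insert i \<beta>"
  obtains "\<gamma> \<subseteq> \<beta>" | \<delta> where "\<delta> \<subseteq> \<beta>" "\<gamma> = insert i \<delta>"
  using assms by (metis insert_Diff subset_insert subset_insert_iff)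

lemma fam_insert_eqI:
  assumes "v \<in> fam V (insert i \<beta>)" "w \<in> fam V (insert i \<beta>)"
    and "\<And>\<gamma>. \<gamma> \<subseteq> \<beta> \<Longrightarrow> v \<gamma> = w \<gamma>" "\<And>\<gamma>. \<gamma> \<subseteq> \<beta> \<Longrightarrow> v (insert i \<gamma>) = w (insert i \<gamma>)"
  shows "v = w"
  by (rule fam_eqI[OF assms(1,2)]) (erule subset_insert_cases, use assms(3,4) in auto)

lemma fsrc_apply: "\<gamma> \<subseteq> \<beta> \<Longrightarrow> fsrc \<beta> v \<gamma> = v \<gamma>"
  by (simp add: fsrc_def)

lemma ftgt_apply: "\<gamma> \<subseteq> \<beta> \<Longrightarrow> ftgt V a i \<beta> v \<gamma> = v \<gamma> \<oplus>\<^bsub>V\<^esub> a \<odot>\<^bsub>V\<^esub> v (insert i \<gamma>)"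
  by (simp add: ftgt_def)

lemma funit_apply: "\<gamma> \<subseteq> insert i \<beta> \<Longrightarrow> funit V i \<beta> v \<gamma> = (if i \<in> \<gamma> then \<zero>\<^bsub>V\<^esub> else v \<gamma>)"
  by (simp add: funit_def)

text \<open>The primed rules evaluate at \<open>\<gamma>\<close> and at
  \<open>insert i \<gamma>\<close> separately, the form in which \<open>join_eqI\<close> poses its
  goals; the unprimed ones keep the case distinction on \<open>i\<close>.\<close>

lemma funit_apply':
  "\<gamma> \<subseteq> \<beta> \<Longrightarrow> i \<notin> \<beta> \<Longrightarrow> funit V i \<beta> v \<gamma> = v \<gamma>"
  "\<gamma> \<subseteq> \<beta> \<Longrightarrow> funit V i \<beta> v (insert i \<gamma>) = \<zero>\<^bsub>V\<^esub>"
  by (auto simp: funit_def)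

lemma fmul_apply':
  "\<gamma> \<subseteq> \<beta> \<Longrightarrow> i \<notin> \<beta> \<Longrightarrow> fmul V i \<beta> w v \<gamma> = v \<gamma>"
  "\<gamma> \<subseteq> \<beta> \<Longrightarrow> fmul V i \<beta> w v (insert i \<gamma>) = v (insert i \<gamma>) \<oplus>\<^bsub>V\<^esub> w (insert i \<gamma>)"
  by (auto simp: fmul_def)

lemma fmul_apply: "\<gamma> \<subseteq> insert i \<beta> \<Longrightarrow>
    fmul V i \<beta> w v \<gamma> = (if i \<in> \<gamma> then v \<gamma> \<oplus>\<^bsub>V\<^esub> w \<gamma> else v \<gamma>)"
  by (simp add: fmul_def)

lemma finv_apply: "\<gamma> \<subseteq> insert i \<beta> \<Longrightarrow>
    finv V a i \<beta> v \<gamma> = (if i \<in> \<gamma> then \<ominus>\<^bsub>V\<^esub> v \<gamma> else v \<gamma> \<oplus>\<^bsub>V\<^esub> a \<odot>\<^bsub>V\<^esub> v (insert i \<gamma>))"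
  by (simp add: finv_def)

section \<open>Families over a larger index set as pairs of families\<close>

lemma join_fam: "x \<in> fam V \<beta> \<Longrightarrow> v \<in> fam V \<beta> \<Longrightarrow> join m \<beta> (x, v) \<in> fam V (insert m \<beta>)"
  by (auto simp: join_def PiE_iff Pi_iff extensional_def subset_insert_iff insert_absorb split: if_splits)

lemma join_apply:
  "m \<notin> \<beta> \<Longrightarrow> \<gamma> \<subseteq> \<beta> \<Longrightarrow> join m \<beta> (x, v) \<gamma> = x \<gamma>"
  "m \<notin> \<beta> \<Longrightarrow> \<gamma> \<subseteq> \<beta> \<Longrightarrow> join m \<beta> (x, v) (insert m \<gamma>) = v \<gamma>"
proof -
  assume a: "m \<notin> \<beta>" "\<gamma> \<subseteq> \<beta>"
  then have "m \<notin> \<gamma>" by auto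
  with a show "join m \<beta> (x, v) \<gamma> = x \<gamma>" "join m \<beta> (x, v) (insert m \<gamma>) = v \<gamma>"
    by (auto simp: join_def)
qed

lemma unjoin_fam:
  assumes "w \<in> fam V (insert m \<beta>)"
  shows "fst (unjoin m \<beta> w) \<in> fam V \<beta>" "snd (unjoin m \<beta> w) \<in> fam V \<beta>"
proof -
  have "w \<gamma> \<in> carrier V" if "\<gamma> \<subseteq> insert m \<beta>" for \<gamma>
    using assms that by (simp add: PiE_iff)
  moreover from this have "w (insert m \<gamma>) \<in> carrier V" if "\<gamma> \<subseteq> \<beta>" for \<gamma>
    using insert_mono[OF that] by simp
  ultimately show "fst (unjoin m \<beta> w) \<in> fam V \<beta>" "snd (unjoin m \<beta> w) \<in> fam V \<beta>"
    by (auto simp: unjoin_def)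
qed

lemma unjoin_apply:
  "\<gamma> \<subseteq> \<beta> \<Longrightarrow> fst (unjoin m \<beta> w) \<gamma> = w \<gamma>"
  "\<gamma> \<subseteq> \<beta> \<Longrightarrow> snd (unjoin m \<beta> w) \<gamma> = w (insert m \<gamma>)"
  by (simp_all add: unjoin_def)

text \<open>An identity for a map transported along \<open>join\<close> splits into one for base
  points and one for tangent vectors.\<close>

lemma join_eqI:
  assumes "m \<notin> \<beta>" "x \<in> fam V \<beta>" "v \<in> fam V \<beta>" "w \<in> fam V (insert m \<beta>)"
    and "\<And>\<gamma>. \<gamma> \<subseteq> \<beta> \<Longrightarrow> x \<gamma> = w \<gamma>" "\<And>\<gamma>. \<gamma> \<subseteq> \<beta> \<Longrightarrow> v \<gamma> = w (insert m \<gamma>)"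
  shows "join m \<beta> (x, v) = w"
  by (rule fam_insert_eqI[OF join_fam[OF assms(2,3)] assms(4)]) (simp_all add: assms join_apply)

lemma join_unjoin:
  assumes "m \<notin> \<beta>" "w \<in> fam V (insert m \<beta>)"
  shows "join m \<beta> (unjoin m \<beta> w) = w"
  using join_eqI[OF assms(1) unjoin_fam[OF assms(2)] assms(2) unjoin_apply] by simp

lemma fsrc_join:
  assumes "m \<notin> \<beta>" "x \<in> fam V \<beta>" "v \<in> fam V \<beta>"
  shows "fsrc \<beta> (join m \<beta> (x, v)) = x"
  \<comment> \<open>With codomain \<open>UNIV\<close> only the extensionality of the two families is
    asked for.\<close>
  by (rule PiE_ext[of _ "Pow \<beta>" "\<lambda>_. UNIV"]) (use assms in \<open>auto simp: fsrc_def join_apply PiE_iff\<close>)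

lemma ftgt_join:
  assumes "m \<notin> \<beta>"
  shows "ftgt V a m \<beta> (join m \<beta> (x, v)) = x \<oplus>\<^bsub>fam_module V \<beta>\<^esub> a \<odot>\<^bsub>fam_module V \<beta>\<^esub> v"
  using assms by (auto simp: ftgt_def join_apply fam_module_def intro!: restrict_ext)

context gsy_data
begin

lemma fsrc_vset: "insert i \<beta> \<subseteq> {1..n} \<Longrightarrow> i \<notin> \<beta> \<Longrightarrow> v \<in> vset K V t U (insert i \<beta>) \<Longrightarrow> fsrc \<beta> v \<in> vset K V t U \<beta>"
  by (simp add: vset_insert)

lemma ftgt_vset:
  "insert i \<beta> \<subseteq> {1..n} \<Longrightarrow> i \<notin> \<beta> \<Longrightarrow> v \<in> vset K V t U (insert i \<beta>) \<Longrightarrow> ftgt V (t i) i \<beta> v \<in> vset K V t U \<beta>"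
  by (simp add: vset_insert)

text \<open>By \<open>fsrc_join\<close> and \<open>ftgt_join\<close>, the two membership conditions
  in \<open>G_set\<close> are those of \<open>vset_insert\<close> for the joined family. Every
  family over \<open>insert m \<beta>\<close> is joined from its two halves, which gives the reverse
  inclusion.\<close>

lemma join_G_set:
  assumes "insert m \<beta> \<subseteq> {1..n}" "m \<notin> \<beta>"
  shows "join m \<beta> ` G_set (fam_module V \<beta>) (t m) (vset K V t U \<beta>) = vset K V t U (insert m \<beta>)"
proof (intro subset_antisym subsetI)
  fix w assume "w \<in> join m \<beta> ` G_set (fam_module V \<beta>) (t m) (vset K V t U \<beta>)"
  then obtain x v where w: "w = join m \<beta> (x, v)" and xv: "x \<in> fam V \<beta>" "v \<in> fam V \<beta>"
    "x \<in> vset K V t U \<beta>" "x \<oplus>\<^bsub>fam_module V \<beta>\<^esub> t m \<odot>\<^bsub>fam_module V \<beta>\<^esub> v \<in> vset K V t U \<beta>"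
    by (auto simp: G_set_def fam_module_def)
  then show "w \<in> vset K V t U (insert m \<beta>)"
    using assms by (simp add: vset_insert join_fam fsrc_join ftgt_join)
next
  fix w assume w: "w \<in> vset K V t U (insert m \<beta>)"
  then have f: "w \<in> fam V (insert m \<beta>)" by (rule vset_fam)
  obtain x v where xv: "unjoin m \<beta> w = (x, v)" by fastforce
  with unjoin_fam[OF f] have xf: "x \<in> fam V \<beta>" "v \<in> fam V \<beta>" by simp_all
  have j: "join m \<beta> (x, v) = w" using join_unjoin[OF assms(2) f] xv by simp
  have "x \<in> vset K V t U \<beta>" "x \<oplus>\<^bsub>fam_module V \<beta>\<^esub> t m \<odot>\<^bsub>fam_module V \<beta>\<^esub> v \<in> vset K V t U \<beta>"
    using w assms xf unfolding j[symmetric] by (simp_all add: vset_insert fsrc_join ftgt_join)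
  then have "(x, v) \<in> G_set (fam_module V \<beta>) (t m) (vset K V t U \<beta>)"
    using xf by (simp add: G_set_def fam_module_def)
  then show "w \<in> join m \<beta> ` G_set (fam_module V \<beta>) (t m) (vset K V t U \<beta>)"
    using j by blast
qed

text \<open>The locale fixes \<open>n\<close>, so the induction runs over the stages
  \<open>m\<close> up to \<open>n\<close>; every parameter it meets then lies in
  \<open>carrier K\<close>.\<close>

lemma Gsy_vert: "m \<le> n \<Longrightarrow> \<alpha> \<subseteq> {1..m} \<Longrightarrow> vert (Gsy V t U m) \<alpha> = vset K V t U \<alpha>"
proof (induction m arbitrary: \<alpha>)
  case 0
  then show ?case by (simp add: vset_empty)
next
  case (Suc m)
  show ?case
  proof (cases "Suc m \<in> \<alpha>")
    case True
    have sub: "\<alpha> - {Suc m} \<subseteq> {1..m}" using Suc.prems by (auto simp: le_Suc_eq)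
    have "insert (Suc m) (\<alpha> - {Suc m}) \<subseteq> {1..n}" using Suc.prems True by auto
    from join_G_set[OF this] have "join (Suc m) (\<alpha> - {Suc m}) `
        G_set (fam_module V (\<alpha> - {Suc m})) (t (Suc m)) (vset K V t U (\<alpha> - {Suc m})) = vset K V t U \<alpha>"
      by (simp only: insert_Diff[OF True]) simp
    moreover have "vert (Gsy V t U m) (\<alpha> - {Suc m}) = vset K V t U (\<alpha> - {Suc m})"
      by (rule Suc.IH[OF _ sub]) (use Suc.prems in simp)
    ultimately show ?thesis
      using True by (simp add: Let_def)
  next
    case False
    then have "\<alpha> \<subseteq> {1..m}" using Suc.prems by (auto simp: le_Suc_eq)
    with Suc.IH[OF _ this] False Suc.prems show ?thesis by (simp add: Let_def)
  qed
qed

lemma fam_edge_G: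
  assumes sub: "insert m \<beta> \<subseteq> {1..n}" and m: "m \<notin> \<beta>"
  shows "fam_edge K V t U m \<beta>
    (gpd_transport id id (join m \<beta>) (unjoin m \<beta>) (G_gpd (fam_module V \<beta>) (t m) (vset K V t U \<beta>)))"
    (is "fam_edge K V t U m \<beta> ?G")
  unfolding fam_edge_def
proof (intro conjI ballI)
  show "gobj ?G = vset K V t U \<beta>" by (simp add: gpd_transport_def G_gpd_def)
  show "gmor ?G = vset K V t U (insert m \<beta>)"
    using join_G_set[OF sub m] by (simp add: gpd_transport_def G_gpd_def)
  fix v assume v: "v \<in> fam V (insert m \<beta>)"
  obtain x a where xa: "unjoin m \<beta> v = (x, a)" by fastforce
  with unjoin_fam[OF v] have f: "x \<in> fam V \<beta>" "a \<in> fam V \<beta>" by simp_all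
  have j: "v = join m \<beta> (x, a)" using join_unjoin[OF m v] xa by simp
  show "gsrc ?G v = fsrc \<beta> v"
    using fsrc_join[OF m f] by (simp add: gpd_transport_def G_gpd_def xa j[symmetric])
  show "gtgt ?G v = ftgt V (t m) m \<beta> v"
    using ftgt_join[OF m, of V "t m" x a] by (simp add: gpd_transport_def G_gpd_def xa j[symmetric])
next
  fix v assume v: "v \<in> fam V \<beta>"
  have z: "\<zero>\<^bsub>fam_module V \<beta>\<^esub> \<in> fam V \<beta>" by (auto simp: fam_module_def)
  have "join m \<beta> (v, \<zero>\<^bsub>fam_module V \<beta>\<^esub>) = funit V m \<beta> v"
    using m by (intro join_eqI[OF m v z funit_fam[OF v]]) (simp_all add: funit_apply' fam_module_def)
  then show "gunit ?G v = funit V m \<beta> v"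
    by (simp add: gpd_transport_def G_gpd_def)
next
  fix w v assume w: "w \<in> fam V (insert m \<beta>)" and v: "v \<in> fam V (insert m \<beta>)"
  obtain x a where xa: "unjoin m \<beta> v = (x, a)" by fastforce
  with unjoin_fam[OF v] have f: "x \<in> fam V \<beta>" "a \<in> fam V \<beta>" by simp_all
  have j: "v = join m \<beta> (x, a)" using join_unjoin[OF m v] xa by simp
  obtain y b where yb: "unjoin m \<beta> w = (y, b)" by fastforce
  with unjoin_fam[OF w] have f': "y \<in> fam V \<beta>" "b \<in> fam V \<beta>" by simp_all
  have j': "w = join m \<beta> (y, b)" using join_unjoin[OF m w] yb by simp
  have s: "a \<oplus>\<^bsub>fam_module V \<beta>\<^esub> b \<in> fam V \<beta>"
    using f f' by (auto simp: fam_module_def fam_mem)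
  have "join m \<beta> (x, a \<oplus>\<^bsub>fam_module V \<beta>\<^esub> b) = fmul V m \<beta> w v"
    using m by (intro join_eqI[OF m f(1) s fmul_fam[OF v w]])
      (simp_all add: fmul_apply' fam_module_def j j' join_apply)
  then show "gcomp ?G w v = fmul V m \<beta> w v"
    by (simp add: gpd_transport_def G_gpd_def xa yb)
qed

text \<open>The formulas in direction \<open>i\<close> combine entries at \<open>\<gamma>\<close>
  and \<open>insert i \<gamma>\<close> only and do not mention \<open>m\<close>. Applying them to
  the base half (indices without \<open>m\<close>) and to the tangent half (indices with
  \<open>m\<close>) and joining is therefore the same as applying them over
  \<open>insert m \<beta>\<close>. The parameter \<open>t m\<close> enters only through the sets of
  objects and morphisms.\<close>

lemma fam_edge_lift:
  assumes sub: "insert i (insert m \<beta>) \<subseteq> {1..n}" and i: "i \<notin> \<beta>" and m: "m \<notin> insert i \<beta>"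
    and G: "fam_edge K V t U i \<beta> G"
  shows "fam_edge K V t U i (insert m \<beta>)
    (gpd_transport (join m \<beta>) (unjoin m \<beta>) (join m (insert i \<beta>)) (unjoin m (insert i \<beta>))
      (G_lift (fam_module V \<beta>) (fam_module V (insert i \<beta>)) (t m) G))"
    (is "fam_edge K V t U i (insert m \<beta>) ?G")
  unfolding fam_edge_def
proof (intro conjI ballI)
  have ti: "t i \<in> carrier K" using sub t_closed by auto
  have m': "m \<notin> \<beta>" "m \<noteq> i" using m by auto
  note eqs = gpd_transport_def G_lift_def G_map_def
  show "gobj ?G = vset K V t U (insert m \<beta>)"
    using join_G_set[of m \<beta>] G sub m by (simp add: eqs fam_edge_def)
  show "gmor ?G = vset K V t U (insert i (insert m \<beta>))"
    using join_G_set[of m "insert i \<beta>"] G sub m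
    by (simp add: eqs fam_edge_def insert_commute[of i m])
  {
    fix v assume v: "v \<in> fam V (insert i (insert m \<beta>))"
    then have v1: "v \<in> fam V (insert m (insert i \<beta>))" by (simp add: insert_commute)
    obtain x a where xa: "unjoin m (insert i \<beta>) v = (x, a)" by fastforce
    with unjoin_fam[OF v1] have f: "x \<in> fam V (insert i \<beta>)" "a \<in> fam V (insert i \<beta>)" by simp_all
    have ap: "x \<gamma> = v \<gamma>" "a \<gamma> = v (insert m \<gamma>)" if "\<gamma> \<subseteq> insert i \<beta>" for \<gamma>
      using unjoin_apply[OF that, of m v] xa by simp_all
    have G': "gsrc G x = fsrc \<beta> x" "gsrc G a = fsrc \<beta> a" "gtgt G x = ftgt V (t i) i \<beta> x"
      "gtgt G a = ftgt V (t i) i \<beta> a"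
      using G f by (simp_all add: fam_edge_def)
    have "join m \<beta> (fsrc \<beta> x, fsrc \<beta> a) = fsrc (insert m \<beta>) v"
    proof (rule join_eqI[OF m'(1) fsrc_fam[OF f(1)] fsrc_fam[OF f(2)] fsrc_fam[OF v]])
      fix \<gamma> assume "\<gamma> \<subseteq> \<beta>"
      then show "fsrc \<beta> x \<gamma> = fsrc (insert m \<beta>) v \<gamma>" "fsrc \<beta> a \<gamma> = fsrc (insert m \<beta>) v (insert m \<gamma>)"
        by (simp_all add: fsrc_apply ap subset_insertI2)
    qed
    then show "gsrc ?G v = fsrc (insert m \<beta>) v"
      by (simp add: eqs xa G')
    have "join m \<beta> (ftgt V (t i) i \<beta> x, ftgt V (t i) i \<beta> a) = ftgt V (t i) i (insert m \<beta>) v"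
    proof (rule join_eqI[OF m'(1) ftgt_fam[OF f(1) ti] ftgt_fam[OF f(2) ti] ftgt_fam[OF v ti]])
      fix \<gamma> assume "\<gamma> \<subseteq> \<beta>"
      then show "ftgt V (t i) i \<beta> x \<gamma> = ftgt V (t i) i (insert m \<beta>) v \<gamma>"
        "ftgt V (t i) i \<beta> a \<gamma> = ftgt V (t i) i (insert m \<beta>) v (insert m \<gamma>)"
        by (simp_all add: ftgt_apply ap subset_insertI2 insert_commute[of i m])
    qed
    then show "gtgt ?G v = ftgt V (t i) i (insert m \<beta>) v"
      by (simp add: eqs xa G')
    fix w assume w: "w \<in> fam V (insert i (insert m \<beta>))"
    then have w1: "w \<in> fam V (insert m (insert i \<beta>))" by (simp add: insert_commute)
    obtain y b where yb: "unjoin m (insert i \<beta>) w = (y, b)" by fastforce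
    with unjoin_fam[OF w1] have f': "y \<in> fam V (insert i \<beta>)" "b \<in> fam V (insert i \<beta>)" by simp_all
    have ap': "y \<gamma> = w \<gamma>" "b \<gamma> = w (insert m \<gamma>)" if "\<gamma> \<subseteq> insert i \<beta>" for \<gamma>
      using unjoin_apply[OF that, of m w] yb by simp_all
    have G'': "gcomp G y x = fmul V i \<beta> y x" "gcomp G b a = fmul V i \<beta> b a"
      using G f f' by (simp_all add: fam_edge_def)
    have fm: "fmul V i (insert m \<beta>) w v \<in> fam V (insert m (insert i \<beta>))"
      using fmul_fam[OF v w] by (simp add: insert_commute)
    have "join m (insert i \<beta>) (fmul V i \<beta> y x, fmul V i \<beta> b a) = fmul V i (insert m \<beta>) w v"
    proof (rule join_eqI[OF m fmul_fam[OF f(1) f'(1)] fmul_fam[OF f(2) f'(2)] fm])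
      fix \<gamma> assume "\<gamma> \<subseteq> insert i \<beta>"
      moreover from this have "\<gamma> \<subseteq> insert i (insert m \<beta>)" by blast
      moreover from this have "insert m \<gamma> \<subseteq> insert i (insert m \<beta>)" by blast
      ultimately show "fmul V i \<beta> y x \<gamma> = fmul V i (insert m \<beta>) w v \<gamma>"
        "fmul V i \<beta> b a \<gamma> = fmul V i (insert m \<beta>) w v (insert m \<gamma>)"
        using m' by (simp_all add: fmul_apply ap ap')
    qed
    then show "gcomp ?G w v = fmul V i (insert m \<beta>) w v"
      by (simp add: eqs xa yb G'')
  }
  fix v assume v: "v \<in> fam V (insert m \<beta>)"
  obtain x a where xa: "unjoin m \<beta> v = (x, a)" by fastforce
  with unjoin_fam[OF v] have f: "x \<in> fam V \<beta>" "a \<in> fam V \<beta>" by simp_all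
  have ap: "x \<gamma> = v \<gamma>" "a \<gamma> = v (insert m \<gamma>)" if "\<gamma> \<subseteq> \<beta>" for \<gamma>
    using unjoin_apply[OF that, of m v] xa by simp_all
  have G': "gunit G x = funit V i \<beta> x" "gunit G a = funit V i \<beta> a"
    using G f by (simp_all add: fam_edge_def)
  have fu: "funit V i (insert m \<beta>) v \<in> fam V (insert m (insert i \<beta>))"
    using funit_fam[OF v] by (simp add: insert_commute)
  have "join m (insert i \<beta>) (funit V i \<beta> x, funit V i \<beta> a) = funit V i (insert m \<beta>) v"
  proof (rule join_eqI[OF m funit_fam[OF f(1)] funit_fam[OF f(2)] fu])
    fix \<gamma> assume g: "\<gamma> \<subseteq> insert i \<beta>"
    moreover from this have "\<gamma> \<subseteq> insert i (insert m \<beta>)" by blast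
    moreover from this have "insert m \<gamma> \<subseteq> insert i (insert m \<beta>)" by blast
    \<comment> \<open>\<open>ap\<close> covers only subsets of \<open>\<beta>\<close>. This
      suffices, because at indices containing \<open>i\<close> both sides are zero.\<close>
    moreover have "\<gamma> \<subseteq> \<beta>" if "i \<notin> \<gamma>" using that g by blast
    ultimately show "funit V i \<beta> x \<gamma> = funit V i (insert m \<beta>) v \<gamma>"
      "funit V i \<beta> a \<gamma> = funit V i (insert m \<beta>) v (insert m \<gamma>)"
      using m' by (simp_all add: funit_apply ap)
  qed
  then show "gunit ?G v = funit V i (insert m \<beta>) v"
    by (simp add: eqs xa G')
qed

lemma Gsy_edge:
  "m \<le> n \<Longrightarrow> insert i \<beta> \<subseteq> {1..m} \<Longrightarrow> i \<notin> \<beta> \<Longrightarrow>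
    fam_edge K V t U i \<beta> (edge (Gsy V t U m) \<beta> (insert i \<beta>))"
proof (induction m arbitrary: \<beta>)
  case 0
  then show ?case by simp
next
  case (Suc m)
  \<comment> \<open>These are the three branches of the recursion: an edge kept from the previous
    stage, a lifted edge, and an edge in the new direction.\<close>
  consider "Suc m \<notin> insert i \<beta>" | "Suc m \<in> \<beta>" | "i = Suc m" by auto
  then show ?case
  proof cases
    case 1
    then have "insert i \<beta> \<subseteq> {1..m}" using Suc.prems by (auto simp: le_Suc_eq)
    with Suc.IH[OF _ this] 1 Suc.prems show ?thesis by (simp add: Let_def)
  next
    case 2
    define \<beta>' where "\<beta>' = \<beta> - {Suc m}"
    have \<beta>: "\<beta> = insert (Suc m) \<beta>'" "i \<noteq> Suc m" "i \<notin> \<beta>'" "Suc m \<notin> \<beta>'"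
      using 2 Suc.prems by (auto simp: \<beta>'_def)
    have sub: "insert i \<beta>' \<subseteq> {1..m}" using Suc.prems \<beta> by (auto simp: le_Suc_eq)
    have diff: "insert i \<beta> - {Suc m} = insert i \<beta>'" using \<beta> by auto
    have "fam_edge K V t U i \<beta>' (edge (Gsy V t U m) \<beta>' (insert i \<beta>'))"
      using Suc.IH[OF _ sub] Suc.prems \<beta> by simp
    moreover have "insert i (insert (Suc m) \<beta>') \<subseteq> {1..n}" using Suc.prems \<beta> by auto
    ultimately show ?thesis
      using fam_edge_lift[of i "Suc m" \<beta>'] \<beta> 2 diff by (simp add: Let_def flip: \<beta>'_def)
  next
    case 3
    then have "\<beta> \<subseteq> {1..m}" using Suc.prems by (auto simp: le_Suc_eq)
    then have "vert (Gsy V t U m) \<beta> = vset K V t U \<beta>" using Suc.prems by (intro Gsy_vert) simp_all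
    moreover have "insert i \<beta> \<subseteq> {1..n}" using Suc.prems by auto
    ultimately show ?thesis
      using fam_edge_G[of i \<beta>] Suc.prems by (simp add: 3 Let_def)
  qed
qed

end

section \<open>Groupoid laws\<close>

context gsy_data
begin

lemma t_closed_insert: "insert i \<beta> \<subseteq> {1..n} \<Longrightarrow> t i \<in> carrier K"
  using t_closed by simp

lemma fsrc_funit: "i \<notin> \<beta> \<Longrightarrow> v \<in> fam V \<beta> \<Longrightarrow> fsrc \<beta> (funit V i \<beta> v) = v"
  by (rule fam_eqI[OF fsrc_fam[OF funit_fam]]) (simp_all add: fsrc_apply funit_apply')

lemma ftgt_funit: "i \<notin> \<beta> \<Longrightarrow> a \<in> carrier K \<Longrightarrow> v \<in> fam V \<beta> \<Longrightarrow> ftgt V a i \<beta> (funit V i \<beta> v) = v"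
  by (rule fam_eqI[OF ftgt_fam[OF funit_fam]]) (simp_all add: ftgt_apply funit_apply' fam_mem smult_r_null)

lemma fsrc_fmul:
  "i \<notin> \<beta> \<Longrightarrow> v \<in> fam V (insert i \<beta>) \<Longrightarrow> w \<in> fam V (insert i \<beta>) \<Longrightarrow>
    fsrc \<beta> (fmul V i \<beta> w v) = fsrc \<beta> v"
  by (rule fam_eqI[OF fsrc_fam[OF fmul_fam] fsrc_fam]) (simp_all add: fsrc_apply fmul_apply')

text \<open>The target entry of the product is \<open>v\<close> at \<open>\<gamma>\<close> plus
  \<open>a\<close> times the sum of the two tangent entries. Composability turns the part coming
  from \<open>v\<close> into the entry of \<open>w\<close> at \<open>\<gamma>\<close>.\<close>

lemma ftgt_fmul:
  assumes i: "i \<notin> \<beta>" and a: "a \<in> carrier K"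
    and v: "v \<in> fam V (insert i \<beta>)" and w: "w \<in> fam V (insert i \<beta>)"
    and c: "ftgt V a i \<beta> v = fsrc \<beta> w"
  shows "ftgt V a i \<beta> (fmul V i \<beta> w v) = ftgt V a i \<beta> w"
proof (rule fam_eqI[OF ftgt_fam[OF fmul_fam[OF v w] a] ftgt_fam[OF w a]])
  fix \<gamma> assume g: "\<gamma> \<subseteq> \<beta>"
  then have g': "\<gamma> \<subseteq> insert i \<beta>" "insert i \<gamma> \<subseteq> insert i \<beta>" by auto
  note cl = fam_mem[OF v g'(1)] fam_mem[OF v g'(2)] fam_mem[OF w g'(1)] fam_mem[OF w g'(2)]
  have "v \<gamma> \<oplus>\<^bsub>V\<^esub> a \<odot>\<^bsub>V\<^esub> v (insert i \<gamma>) = w \<gamma>"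
    using fun_cong[OF c, of \<gamma>] g by (simp add: ftgt_apply fsrc_apply)
  with i a g cl show "ftgt V a i \<beta> (fmul V i \<beta> w v) \<gamma> = ftgt V a i \<beta> w \<gamma>"
    by (simp add: ftgt_apply fmul_apply' smult_r_distr M.a_assoc[symmetric])
qed

lemma funit_vset:
  assumes "insert i \<beta> \<subseteq> {1..n}" "i \<notin> \<beta>" "v \<in> vset K V t U \<beta>"
  shows "funit V i \<beta> v \<in> vset K V t U (insert i \<beta>)"
  using assms vset_fam[OF assms(3)] t_closed_insert[OF assms(1)]
  by (simp add: vset_insert funit_fam fsrc_funit ftgt_funit)

lemma fmul_vset:
  assumes "insert i \<beta> \<subseteq> {1..n}" "i \<notin> \<beta>" "v \<in> vset K V t U (insert i \<beta>)" "w \<in> vset K V t U (insert i \<beta>)"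
    "ftgt V (t i) i \<beta> v = fsrc \<beta> w"
  shows "fmul V i \<beta> w v \<in> vset K V t U (insert i \<beta>)"
  using assms t_closed_insert[OF assms(1)] by (simp add: vset_insert fmul_fam fsrc_fmul ftgt_fmul)

lemma fsrc_finv:
  assumes "i \<notin> \<beta>" "a \<in> carrier K" "v \<in> fam V (insert i \<beta>)"
  shows "fsrc \<beta> (finv V a i \<beta> v) = ftgt V a i \<beta> v"
proof (rule fam_eqI[OF fsrc_fam[OF finv_fam[OF assms(3,2)]] ftgt_fam[OF assms(3,2)]])
  fix \<gamma> assume g: "\<gamma> \<subseteq> \<beta>"
  then have "\<gamma> \<subseteq> insert i \<beta>" "i \<notin> \<gamma>" using assms(1) by auto
  with g show "fsrc \<beta> (finv V a i \<beta> v) \<gamma> = ftgt V a i \<beta> v \<gamma>"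
    by (simp add: fsrc_apply ftgt_apply finv_apply)
qed

lemma ftgt_finv:
  assumes "i \<notin> \<beta>" "a \<in> carrier K" "v \<in> fam V (insert i \<beta>)"
  shows "ftgt V a i \<beta> (finv V a i \<beta> v) = fsrc \<beta> v"
proof (rule fam_eqI[OF ftgt_fam[OF finv_fam[OF assms(3,2)] assms(2)] fsrc_fam[OF assms(3)]])
  fix \<gamma> assume g: "\<gamma> \<subseteq> \<beta>"
  then have g': "\<gamma> \<subseteq> insert i \<beta>" "insert i \<gamma> \<subseteq> insert i \<beta>" "i \<notin> \<gamma>" using assms(1) by auto
  note cl = fam_mem[OF assms(3) g'(1)] fam_mem[OF assms(3) g'(2)]
  with g g' assms(2) show "ftgt V a i \<beta> (finv V a i \<beta> v) \<gamma> = fsrc \<beta> v \<gamma>"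
    by (simp add: fsrc_apply ftgt_apply finv_apply smult_r_minus M.a_assoc M.r_neg)
qed

lemma finv_vset:
  assumes "insert i \<beta> \<subseteq> {1..n}" "i \<notin> \<beta>" "v \<in> vset K V t U (insert i \<beta>)"
  shows "finv V (t i) i \<beta> v \<in> vset K V t U (insert i \<beta>)"
  using assms t_closed_insert[OF assms(1)] by (simp add: vset_insert finv_fam fsrc_finv ftgt_finv)

lemma fmul_assoc:
  assumes "u \<in> fam V (insert i \<beta>)" "v \<in> fam V (insert i \<beta>)" "w \<in> fam V (insert i \<beta>)"
  shows "fmul V i \<beta> w (fmul V i \<beta> v u) = fmul V i \<beta> (fmul V i \<beta> w v) u"
  by (rule fam_eqI[OF fmul_fam[OF fmul_fam] fmul_fam[OF _ fmul_fam]])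
    (use assms in \<open>simp_all add: fmul_apply fam_mem M.a_assoc\<close>)

lemma fmul_funit:
  assumes "i \<notin> \<beta>" "a \<in> carrier K" and v: "v \<in> fam V (insert i \<beta>)"
  shows "fmul V i \<beta> v (funit V i \<beta> (fsrc \<beta> v)) = v"
    and "fmul V i \<beta> (funit V i \<beta> (ftgt V a i \<beta> v)) v = v"
proof -
  show "fmul V i \<beta> v (funit V i \<beta> (fsrc \<beta> v)) = v"
    by (rule fam_eqI[OF fmul_fam[OF funit_fam[OF fsrc_fam[OF v]] v] v])
      (auto simp: fmul_apply funit_apply fsrc_apply subset_insert fam_mem[OF v])
  show "fmul V i \<beta> (funit V i \<beta> (ftgt V a i \<beta> v)) v = v"
    by (rule fam_eqI[OF fmul_fam[OF v funit_fam[OF ftgt_fam[OF v assms(2)]]] v])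
      (auto simp: fmul_apply funit_apply ftgt_apply subset_insert fam_mem[OF v])
qed

lemma fmul_finv:
  assumes "i \<notin> \<beta>" and a: "a \<in> carrier K" and v: "v \<in> fam V (insert i \<beta>)"
  shows "fmul V i \<beta> (finv V a i \<beta> v) v = funit V i \<beta> (fsrc \<beta> v)"
    and "fmul V i \<beta> v (finv V a i \<beta> v) = funit V i \<beta> (ftgt V a i \<beta> v)"
proof -
  show "fmul V i \<beta> (finv V a i \<beta> v) v = funit V i \<beta> (fsrc \<beta> v)"
    by (rule fam_eqI[OF fmul_fam[OF v finv_fam[OF v a]] funit_fam[OF fsrc_fam[OF v]]])
      (auto simp: fmul_apply funit_apply fsrc_apply finv_apply subset_insert fam_mem[OF v] M.r_neg)
  show "fmul V i \<beta> v (finv V a i \<beta> v) = funit V i \<beta> (ftgt V a i \<beta> v)"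
    by (rule fam_eqI[OF fmul_fam[OF finv_fam[OF v a] v] funit_fam[OF ftgt_fam[OF v a]]])
      (auto simp: fmul_apply funit_apply ftgt_apply finv_apply subset_insert fam_mem[OF v] M.l_neg)
qed

section \<open>From the edge formulas to groupoids and double groupoids\<close>

lemma fam_edge_composable:
  assumes "fam_edge K V t U i \<beta> G" "composable G w v"
  shows "v \<in> vset K V t U (insert i \<beta>)" "w \<in> vset K V t U (insert i \<beta>)"
    "v \<in> fam V (insert i \<beta>)" "w \<in> fam V (insert i \<beta>)"
    "ftgt V (t i) i \<beta> v = fsrc \<beta> w" "gcomp G w v = fmul V i \<beta> w v"
proof -
  show v: "v \<in> vset K V t U (insert i \<beta>)" and w: "w \<in> vset K V t U (insert i \<beta>)"
    using assms by (simp_all add: composable_def fam_edge_def)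
  from v show v': "v \<in> fam V (insert i \<beta>)" by (rule vset_fam)
  from w show w': "w \<in> fam V (insert i \<beta>)" by (rule vset_fam)
  show "ftgt V (t i) i \<beta> v = fsrc \<beta> w" "gcomp G w v = fmul V i \<beta> w v"
    using assms v' w' by (simp_all add: composable_def fam_edge_def)
qed

lemma fam_edge_groupoid:
  assumes sub: "insert i \<beta> \<subseteq> {1..n}" and i: "i \<notin> \<beta>" and G: "fam_edge K V t U i \<beta> G"
  shows "groupoid G"
proof -
  note ti = t_closed_insert[OF sub]
  have o: "gobj G = vset K V t U \<beta>" and m: "gmor G = vset K V t U (insert i \<beta>)"
    and s: "\<And>v. v \<in> fam V (insert i \<beta>) \<Longrightarrow> gsrc G v = fsrc \<beta> v"
    and g: "\<And>v. v \<in> fam V (insert i \<beta>) \<Longrightarrow> gtgt G v = ftgt V (t i) i \<beta> v"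
    and u: "\<And>v. v \<in> fam V \<beta> \<Longrightarrow> gunit G v = funit V i \<beta> v"
    and c: "\<And>v w. v \<in> fam V (insert i \<beta>) \<Longrightarrow> w \<in> fam V (insert i \<beta>) \<Longrightarrow> gcomp G w v = fmul V i \<beta> w v"
    using G by (auto simp: fam_edge_def)
  note [simp] = o m s g u c vset_fam fsrc_fam ftgt_fam[OF _ ti] funit_fam fmul_fam finv_fam[OF _ ti]
    fsrc_vset[OF sub i] ftgt_vset[OF sub i] funit_vset[OF sub i] fmul_vset[OF sub i] finv_vset[OF sub i]
    fsrc_funit[OF i] ftgt_funit[OF i ti] fsrc_fmul[OF i] ftgt_fmul[OF i ti] fsrc_finv[OF i ti] ftgt_finv[OF i ti]
    fmul_funit[OF i ti] fmul_finv[OF i ti]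
  show ?thesis
    unfolding groupoid_def
  proof (intro conjI allI ballI impI funcsetI)
    fix w v assume "composable G w v"
    note cw = fam_edge_composable[OF G this]
    then show "gcomp G w v \<in> gmor G" "gsrc G (gcomp G w v) = gsrc G v" "gtgt G (gcomp G w v) = gtgt G w"
      by simp_all
  next
    fix w v u assume *: "composable G w v \<and> composable G v u"
    with fam_edge_composable[OF G, of w v] fam_edge_composable[OF G, of v u]
    show "gcomp G w (gcomp G v u) = gcomp G (gcomp G w v) u"
      by (simp add: fmul_assoc)
  next
    fix v assume "v \<in> gmor G"
    then show "\<exists>h\<in>gmor G. gsrc G h = gtgt G v \<and> gtgt G h = gsrc G v \<and>
        gcomp G h v = gunit G (gsrc G v) \<and> gcomp G v h = gunit G (gtgt G v)"
      by (intro bexI[of _ "finv V (t i) i \<beta> v"]) simp_all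
  qed simp_all
qed

text \<open>The operations in directions \<open>i\<close> and \<open>j\<close> commute because they
  act on different elements of the index. Only the functoriality of the \<open>j\<close>-maps along
  direction \<open>i\<close> is stated; the other half is the same lemma with the two directions
  exchanged.\<close>

lemma double_homs:
  assumes sub: "insert i (insert j \<beta>) \<subseteq> {1..n}" and ij: "i \<notin> insert j \<beta>" "j \<notin> \<beta>"
    and H0: "fam_edge K V t U i \<beta> H0" and H1: "fam_edge K V t U i (insert j \<beta>) H1"
    and V0: "fam_edge K V t U j \<beta> V0" and V1: "fam_edge K V t U j (insert i \<beta>) V1"
  shows "gpd_hom H1 H0 (gsrc V0) (gsrc V1)" "gpd_hom H1 H0 (gtgt V0) (gtgt V1)"
    "gpd_hom H0 H1 (gunit V0) (gunit V1)"
proof -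
  \<comment> \<open>The top vertex of the square arises in two orders; \<open>cm\<close> makes
    \<open>insert i (insert j \<beta>)\<close> its normal form.\<close>
  have cm: "insert j (insert i \<beta>) = insert i (insert j \<beta>)" by (rule insert_commute)
  have ins: "\<gamma> \<subseteq> insert i (insert j \<beta>)" if "\<gamma> \<subseteq> insert i \<beta>" for \<gamma>
    using that by blast
  have ins': "\<gamma> \<subseteq> insert i \<beta>" if "\<gamma> \<subseteq> insert i (insert j \<beta>)" "j \<notin> \<gamma>" for \<gamma>
    using that by blast
  have sub': "insert i \<beta> \<subseteq> {1..n}" "insert j \<beta> \<subseteq> {1..n}" "insert j (insert i \<beta>) \<subseteq> {1..n}"
    using sub by auto
  have ij': "i \<notin> \<beta>" "i \<noteq> j" "j \<notin> insert i \<beta>" using ij by auto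
  note ti = t_closed_insert[OF sub'(1)] and tj = t_closed_insert[OF sub'(2)]
  have fc: "v \<in> fam V (insert j (insert i \<beta>))" if "v \<in> fam V (insert i (insert j \<beta>))" for v
    using that by (simp add: cm)
  have mem: "v \<gamma> \<in> carrier V" "v (insert i \<gamma>) \<in> carrier V" "v (insert j \<gamma>) \<in> carrier V"
    "v (insert i (insert j \<gamma>)) \<in> carrier V"
    if "v \<in> fam V (insert i (insert j \<beta>))" "\<gamma> \<subseteq> \<beta>" for v \<gamma>
    using that by (auto intro!: fam_mem[of v "insert i (insert j \<beta>)"])
  note fams = fsrc_fam[OF fc] ftgt_fam[OF fc tj] fsrc_fam[of _ i "insert j \<beta>"] fsrc_fam[of _ i \<beta>] fsrc_fam[of _ j \<beta>] ftgt_fam[OF _ ti] ftgt_fam[OF _ tj] funit_fam fmul_fam fc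
  have ss: "fsrc \<beta> (fsrc (insert i \<beta>) v) = fsrc \<beta> (fsrc (insert j \<beta>) v)"
    and ts: "ftgt V (t i) i \<beta> (fsrc (insert i \<beta>) v) = fsrc \<beta> (ftgt V (t i) i (insert j \<beta>) v)"
    and st: "fsrc \<beta> (ftgt V (t j) j (insert i \<beta>) v) = ftgt V (t j) j \<beta> (fsrc (insert j \<beta>) v)"
    and tt: "ftgt V (t i) i \<beta> (ftgt V (t j) j (insert i \<beta>) v) = ftgt V (t j) j \<beta> (ftgt V (t i) i (insert j \<beta>) v)"
    if v: "v \<in> fam V (insert i (insert j \<beta>))" for v
  proof -
    show "fsrc \<beta> (fsrc (insert i \<beta>) v) = fsrc \<beta> (fsrc (insert j \<beta>) v)"
      by (auto simp: fsrc_def intro!: restrict_ext)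
    show "ftgt V (t i) i \<beta> (fsrc (insert i \<beta>) v) = fsrc \<beta> (ftgt V (t i) i (insert j \<beta>) v)"
      by (auto simp: fsrc_def ftgt_def intro!: restrict_ext)
    show "fsrc \<beta> (ftgt V (t j) j (insert i \<beta>) v) = ftgt V (t j) j \<beta> (fsrc (insert j \<beta>) v)"
      by (auto simp: fsrc_def ftgt_def intro!: restrict_ext)
    show "ftgt V (t i) i \<beta> (ftgt V (t j) j (insert i \<beta>) v) = ftgt V (t j) j \<beta> (ftgt V (t i) i (insert j \<beta>) v)"
    proof (rule fam_eqI[OF ftgt_fam[OF ftgt_fam[OF fc[OF v] tj] ti] ftgt_fam[OF ftgt_fam[OF v ti] tj]])
      fix \<gamma> assume g: "\<gamma> \<subseteq> \<beta>"
      \<comment> \<open>Going down by two targets, the entry at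
        \<open>insert i (insert j \<gamma>)\<close> receives the factors \<open>t i\<close> and
        \<open>t j\<close> in an order that depends on the path; commutativity of \<open>K\<close>
        makes the paths agree.\<close>
      have sm: "t i \<odot>\<^bsub>V\<^esub> (t j \<odot>\<^bsub>V\<^esub> x) = t j \<odot>\<^bsub>V\<^esub> (t i \<odot>\<^bsub>V\<^esub> x)" if "x \<in> carrier V" for x
        using ti tj that by (metis smult_assoc1 R.m_comm)
      show "ftgt V (t i) i \<beta> (ftgt V (t j) j (insert i \<beta>) v) \<gamma> = ftgt V (t j) j \<beta> (ftgt V (t i) i (insert j \<beta>) v) \<gamma>"
        using g mem[OF v g] ti tj
        by (simp add: ftgt_apply subset_insertI2 smult_r_distr M.a_ac sm insert_commute[of j i])
    qed
  qed
  have su: "fsrc (insert j \<beta>) (funit V j (insert i \<beta>) v) = funit V j \<beta> (fsrc \<beta> v)"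
    and tu: "ftgt V (t i) i (insert j \<beta>) (funit V j (insert i \<beta>) v) = funit V j \<beta> (ftgt V (t i) i \<beta> v)"
    if v: "v \<in> fam V (insert i \<beta>)" for v
  proof -
    have fu: "funit V j (insert i \<beta>) v \<in> fam V (insert i (insert j \<beta>))"
      using funit_fam[OF v, of j] by (simp add: cm)
    show "fsrc (insert j \<beta>) (funit V j (insert i \<beta>) v) = funit V j \<beta> (fsrc \<beta> v)"
      by (rule fam_eqI[OF fsrc_fam[OF fu] funit_fam[OF fsrc_fam[OF v]]])
        (auto simp: fsrc_apply funit_apply subset_insert cm ins subset_insertI2)
    show "ftgt V (t i) i (insert j \<beta>) (funit V j (insert i \<beta>) v) = funit V j \<beta> (ftgt V (t i) i \<beta> v)"
      using ti ij' by (intro fam_eqI[OF ftgt_fam[OF fu ti] funit_fam[OF ftgt_fam[OF v ti]]])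
        (auto simp: ftgt_apply funit_apply subset_insert cm ins subset_insertI2 smult_r_null)
  qed
  have us: "funit V i \<beta> (fsrc \<beta> v) = fsrc (insert i \<beta>) (funit V i (insert j \<beta>) v)"
    and ut: "funit V i \<beta> (ftgt V (t j) j \<beta> v) = ftgt V (t j) j (insert i \<beta>) (funit V i (insert j \<beta>) v)"
    if v: "v \<in> fam V (insert j \<beta>)" for v
  proof -
    have fu: "funit V i (insert j \<beta>) v \<in> fam V (insert j (insert i \<beta>))"
      using funit_fam[OF v, of i] by (simp add: cm)
    show "funit V i \<beta> (fsrc \<beta> v) = fsrc (insert i \<beta>) (funit V i (insert j \<beta>) v)"
      by (rule fam_eqI[OF funit_fam[OF fsrc_fam[OF v]] fsrc_fam[OF fu]])
        (auto simp: fsrc_apply funit_apply subset_insert cm ins subset_insertI2)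
    show "funit V i \<beta> (ftgt V (t j) j \<beta> v) = ftgt V (t j) j (insert i \<beta>) (funit V i (insert j \<beta>) v)"
      using tj ij' by (intro fam_eqI[OF funit_fam[OF ftgt_fam[OF v tj]] ftgt_fam[OF fu tj]])
        (auto simp: ftgt_apply funit_apply subset_insert cm ins subset_insertI2 smult_r_null)
  qed
  have uu: "funit V i (insert j \<beta>) (funit V j \<beta> v) = funit V j (insert i \<beta>) (funit V i \<beta> v)"
    if v: "v \<in> fam V \<beta>" for v
  proof -
    have fu: "funit V j (insert i \<beta>) (funit V i \<beta> v) \<in> fam V (insert i (insert j \<beta>))"
      using funit_fam[OF funit_fam[OF v, of i], of j] by (simp add: cm)
    show ?thesis
      by (rule fam_eqI[OF funit_fam[OF funit_fam[OF v]] fu])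
        (auto simp: funit_apply subset_insert cm ins')
  qed
  have cs: "fsrc (insert i \<beta>) (fmul V i (insert j \<beta>) w v) = fmul V i \<beta> (fsrc (insert i \<beta>) w) (fsrc (insert i \<beta>) v)"
    and ct: "ftgt V (t j) j (insert i \<beta>) (fmul V i (insert j \<beta>) w v)
      = fmul V i \<beta> (ftgt V (t j) j (insert i \<beta>) w) (ftgt V (t j) j (insert i \<beta>) v)"
    if v: "v \<in> fam V (insert i (insert j \<beta>))" and w: "w \<in> fam V (insert i (insert j \<beta>))" for v w
  proof -
    have fu: "fmul V i (insert j \<beta>) w v \<in> fam V (insert j (insert i \<beta>))"
      using fmul_fam[OF v w] by (simp add: cm)
    show "fsrc (insert i \<beta>) (fmul V i (insert j \<beta>) w v) = fmul V i \<beta> (fsrc (insert i \<beta>) w) (fsrc (insert i \<beta>) v)"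
      by (rule fam_eqI[OF fsrc_fam[OF fu] fmul_fam[OF fsrc_fam[OF fc[OF v]] fsrc_fam[OF fc[OF w]]]])
        (auto simp: fsrc_apply fmul_apply cm ins subset_insertI2 subset_insert)
    show "ftgt V (t j) j (insert i \<beta>) (fmul V i (insert j \<beta>) w v)
      = fmul V i \<beta> (ftgt V (t j) j (insert i \<beta>) w) (ftgt V (t j) j (insert i \<beta>) v)"
    proof (rule fam_eqI[OF ftgt_fam[OF fu tj] fmul_fam[OF ftgt_fam[OF fc[OF v] tj] ftgt_fam[OF fc[OF w] tj]]])
      fix \<gamma> assume g: "\<gamma> \<subseteq> insert i \<beta>"
      then have g': "\<gamma> \<subseteq> insert i (insert j \<beta>)" "insert j \<gamma> \<subseteq> insert i (insert j \<beta>)" by auto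
      note cl = fam_mem[OF v g'(1)] fam_mem[OF v g'(2)] fam_mem[OF w g'(1)] fam_mem[OF w g'(2)]
      \<comment> \<open>At an index with \<open>i\<close> the entries of \<open>v\<close> and
        \<open>w\<close> add up on both sides, and \<open>t j\<close> distributes over the sum; at
        an index without \<open>i\<close> both sides are the target entry of \<open>v\<close>. Since
        \<open>i\<close> differs from \<open>j\<close>, inserting \<open>j\<close> does not change
        the case.\<close>
      show "ftgt V (t j) j (insert i \<beta>) (fmul V i (insert j \<beta>) w v) \<gamma>
        = fmul V i \<beta> (ftgt V (t j) j (insert i \<beta>) w) (ftgt V (t j) j (insert i \<beta>) v) \<gamma>"
        using g g' cl tj ij' by (auto simp: ftgt_apply fmul_apply smult_r_distr M.a_ac)
    qed
  qed
  have cu: "funit V j (insert i \<beta>) (fmul V i \<beta> w v) = fmul V i (insert j \<beta>) (funit V j (insert i \<beta>) w) (funit V j (insert i \<beta>) v)"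
    if v: "v \<in> fam V (insert i \<beta>)" and w: "w \<in> fam V (insert i \<beta>)" for v w
  proof -
    have fu: "funit V j (insert i \<beta>) x \<in> fam V (insert i (insert j \<beta>))" if "x \<in> fam V (insert i \<beta>)" for x
      using funit_fam[OF that, of j] by (simp add: cm)
    show ?thesis
      by (rule fam_eqI[OF fu[OF fmul_fam[OF v w]] fmul_fam[OF fu[OF v] fu[OF w]]])
        (auto simp: funit_apply fmul_apply cm ins' subset_insert)
  qed
  have fu': "funit V j (insert i \<beta>) v \<in> fam V (insert i (insert j \<beta>))" if "v \<in> fam V (insert i \<beta>)" for v
    using funit_fam[OF that, of j] by (simp add: cm)
  have vu: "funit V j (insert i \<beta>) v \<in> vset K V t U (insert i (insert j \<beta>))" if "v \<in> vset K V t U (insert i \<beta>)" for v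
    using funit_vset[OF sub'(3) ij'(3) that] by (simp add: cm)
  have vs: "fsrc (insert i \<beta>) v \<in> vset K V t U (insert i \<beta>)" "ftgt V (t j) j (insert i \<beta>) v \<in> vset K V t U (insert i \<beta>)"
    if "v \<in> vset K V t U (insert i (insert j \<beta>))" for v
    using that fsrc_vset[OF sub'(3) ij'(3), of v] ftgt_vset[OF sub'(3) ij'(3), of v] by (simp_all add: cm)
  note G = H0[unfolded fam_edge_def] H1[unfolded fam_edge_def] V0[unfolded fam_edge_def] V1[unfolded fam_edge_def cm]
  note eqs = vset_fam fams vs vu fu' fsrc_vset[OF sub'(2) ij(2)] ftgt_vset[OF sub'(2) ij(2)] funit_vset[OF sub'(2) ij(2)]
  show "gpd_hom H1 H0 (gsrc V0) (gsrc V1)"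
    unfolding gpd_hom_def
  proof (intro conjI allI ballI impI funcsetI)
    fix w v assume "composable H1 w v"
    note cw = fam_edge_composable[OF H1 this]
    show "gsrc V1 (gcomp H1 w v) = gcomp H0 (gsrc V1 w) (gsrc V1 v)"
      using G cw cs[OF cw(3,4)] by (simp add: eqs)
  qed (use G in \<open>auto simp: eqs ss ts us\<close>)
  show "gpd_hom H1 H0 (gtgt V0) (gtgt V1)"
    unfolding gpd_hom_def
  proof (intro conjI allI ballI impI funcsetI)
    fix w v assume "composable H1 w v"
    note cw = fam_edge_composable[OF H1 this]
    show "gtgt V1 (gcomp H1 w v) = gcomp H0 (gtgt V1 w) (gtgt V1 v)"
      using G cw ct[OF cw(3,4)] by (simp add: eqs)
  qed (use G in \<open>auto simp: eqs st tt ut\<close>)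
  show "gpd_hom H0 H1 (gunit V0) (gunit V1)"
    unfolding gpd_hom_def
  proof (intro conjI allI ballI impI funcsetI)
    fix w v assume "composable H0 w v"
    note cw = fam_edge_composable[OF H0 this]
    show "gunit V1 (gcomp H0 w v) = gcomp H1 (gunit V1 w) (gunit V1 v)"
      using G cw cu[OF cw(3,4)] by (simp add: eqs)
  qed (use G in \<open>auto simp: eqs su tu uu\<close>)
qed

text \<open>At an index containing both directions each side is the sum of all four entries. With
  only \<open>i\<close> it is that of \<open>c\<close> and \<open>d\<close>, with only
  \<open>j\<close> that of \<open>b\<close> and \<open>d\<close>, and with neither it is the entry
  of \<open>d\<close>.\<close>

lemma fmul_interchange:
  assumes "a \<in> fam V (insert i (insert j \<beta>))" "b \<in> fam V (insert i (insert j \<beta>))"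
    "c \<in> fam V (insert i (insert j \<beta>))" "d \<in> fam V (insert i (insert j \<beta>))"
  shows "fmul V j (insert i \<beta>) (fmul V i (insert j \<beta>) a b) (fmul V i (insert j \<beta>) c d)
    = fmul V i (insert j \<beta>) (fmul V j (insert i \<beta>) a c) (fmul V j (insert i \<beta>) b d)"
    (is "?l = ?r")
proof -
  have cm: "insert j (insert i \<beta>) = insert i (insert j \<beta>)" by (rule insert_commute)
  have f: "fmul V j (insert i \<beta>) x y \<in> fam V (insert i (insert j \<beta>))"
    if "x \<in> fam V (insert i (insert j \<beta>))" "y \<in> fam V (insert i (insert j \<beta>))" for x y
    using fmul_fam[of y j "insert i \<beta>" x] that by (simp add: cm)
  show ?thesis
    by (rule fam_eqI[where V = V and \<alpha> = "insert i (insert j \<beta>)"])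
      (use assms in \<open>auto simp: f fmul_fam fmul_apply cm fam_mem M.a_ac\<close>)
qed

lemma fam_edge_double:
  assumes sub: "insert i (insert j \<beta>) \<subseteq> {1..n}" and ij: "i \<notin> insert j \<beta>" "j \<notin> \<beta>"
    and H0: "fam_edge K V t U i \<beta> H0" and H1: "fam_edge K V t U i (insert j \<beta>) H1"
    and V0: "fam_edge K V t U j \<beta> V0" and V1: "fam_edge K V t U j (insert i \<beta>) V1"
  shows "double_groupoid H0 H1 V0 V1"
proof -
  have cm: "insert j (insert i \<beta>) = insert i (insert j \<beta>)" by (rule insert_commute)
  have sub': "insert i \<beta> \<subseteq> {1..n}" "insert j \<beta> \<subseteq> {1..n}" "insert j (insert i \<beta>) \<subseteq> {1..n}"
    using sub by auto
  have ij': "i \<notin> \<beta>" "j \<notin> insert i \<beta>" using ij by auto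
  note G = H0[unfolded fam_edge_def] H1[unfolded fam_edge_def] V0[unfolded fam_edge_def] V1[unfolded fam_edge_def cm]
  show ?thesis
    unfolding double_groupoid_def
  proof (intro conjI allI impI)
    show "groupoid H0" "groupoid H1" "groupoid V0" "groupoid V1"
      using fam_edge_groupoid sub sub' ij ij' H0 H1 V0 V1 by blast+
    show "gobj H0 = gobj V0" "gmor H0 = gobj V1" "gmor V0 = gobj H1" "gmor H1 = gmor V1"
      using G by simp_all
    \<comment> \<open>The second instance exchanges \<open>i\<close> with \<open>j\<close> and the
      horizontal with the vertical edges, and supplies the remaining three functors.\<close>
    note h = double_homs[OF sub ij H0 H1 V0 V1] double_homs[OF sub'(3) ij'(2,1) V0 V1 H0 H1]
    show "gpd_hom H1 H0 (gsrc V0) (gsrc V1)" "gpd_hom H1 H0 (gtgt V0) (gtgt V1)"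
      "gpd_hom H0 H1 (gunit V0) (gunit V1)" "gpd_hom V1 V0 (gsrc H0) (gsrc H1)"
      "gpd_hom V1 V0 (gtgt H0) (gtgt H1)" "gpd_hom V0 V1 (gunit H0) (gunit H1)"
      by (fact h)+
    fix a b c d assume "composable H1 a b \<and> composable H1 c d \<and> composable V1 a c \<and> composable V1 b d"
    then have co: "composable H1 a b" "composable H1 c d" "composable V1 a c" "composable V1 b d" by auto
    note c1 = fam_edge_composable[OF H1 co(1)] fam_edge_composable[OF H1 co(2)]
    note c2 = fam_edge_composable[OF V1 co(3)] fam_edge_composable[OF V1 co(4)]
    have f: "fmul V j (insert i \<beta>) x y \<in> fam V (insert i (insert j \<beta>))"
      if "x \<in> fam V (insert i (insert j \<beta>))" "y \<in> fam V (insert i (insert j \<beta>))" for x y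
      using fmul_fam[of y j "insert i \<beta>" x] that by (simp add: cm)
    show "gcomp V1 (gcomp H1 a b) (gcomp H1 c d) = gcomp H1 (gcomp V1 a c) (gcomp V1 b d)"
      using G c1 c2 by (simp add: f fmul_fam fmul_interchange)
  qed
qed

lemma Gsy_nfold_groupoid: "nfold_groupoid n (Gsy V t U n)"
  unfolding nfold_groupoid_def
proof (intro conjI allI impI; elim conjE)
  fix \<beta> i assume a: "\<beta> \<subseteq> {1..n}" "i \<in> {1..n} - \<beta>"
  then have a': "insert i \<beta> \<subseteq> {1..n}" "i \<notin> \<beta>" by auto
  note G = Gsy_edge[OF le_refl a']
  show "groupoid (edge (Gsy V t U n) \<beta> (insert i \<beta>))"
    using fam_edge_groupoid[OF a' G] .
  show "gobj (edge (Gsy V t U n) \<beta> (insert i \<beta>)) = vert (Gsy V t U n) \<beta>"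
    "gmor (edge (Gsy V t U n) \<beta> (insert i \<beta>)) = vert (Gsy V t U n) (insert i \<beta>)"
    using G a a' by (simp_all add: Gsy_vert fam_edge_def)
next
  fix \<beta> i j assume "\<beta> \<subseteq> {1..n}" "i \<in> {1..n} - \<beta>" "j \<in> {1..n} - \<beta>" "i \<noteq> j"
  then show "double_groupoid
      (edge (Gsy V t U n) \<beta> (insert i \<beta>)) (edge (Gsy V t U n) (insert j \<beta>) (insert i (insert j \<beta>)))
      (edge (Gsy V t U n) \<beta> (insert j \<beta>)) (edge (Gsy V t U n) (insert i \<beta>) (insert i (insert j \<beta>)))"
    using Gsy_edge[OF le_refl, of i \<beta>] Gsy_edge[OF le_refl, of i "insert j \<beta>"]
      Gsy_edge[OF le_refl, of j \<beta>] Gsy_edge[OF le_refl, of j "insert i \<beta>"]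
    by (intro fam_edge_double[of i j \<beta>]) (simp_all add: insert_commute)
qed

end

section \<open>Permutation of directions\<close>

text \<open>Permuted parameter sequences are only known to agree on \<open>{1..n}\<close>: for the
  flip, the two sequences obtained from \<open>params2\<close> differ outside \<open>{1, 2}\<close>
  as soon as the parameters differ.\<close>

lemma Gsy_cong: "(\<And>i. i \<in> {1..n} \<Longrightarrow> t i = s i) \<Longrightarrow> Gsy V t U n = Gsy V s U n"
proof (induction n)
  case (Suc n)
  then have "Gsy V t U n = Gsy V s U n" "t (Suc n) = s (Suc n)" by simp_all
  then show ?case by (simp add: Let_def cong: if_cong)
qed simp

text \<open>\<open>G_map\<close> treats base point and tangent vector alike and \<open>join\<close>
  merely relabels indices, so the iteration amounts to applying \<open>f\<close> to each
  entry.\<close>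

lemma Gsy_map_apply: "\<alpha> \<subseteq> {1..n} \<Longrightarrow> Gsy_map f n \<alpha> v = (\<lambda>\<gamma>\<in>Pow \<alpha>. f (v \<gamma>))"
proof (induction n arbitrary: \<alpha> v)
  case 0
  then show ?case by (auto simp: pt_def)
next
  case (Suc n)
  show ?case
  proof (cases "Suc n \<in> \<alpha>")
    case True
    define \<beta> where "\<beta> = \<alpha> - {Suc n}"
    have \<beta>: "\<alpha> = insert (Suc n) \<beta>" "Suc n \<notin> \<beta>" "\<beta> \<subseteq> {1..n}"
      using True Suc.prems by (auto simp: \<beta>_def le_Suc_eq)
    have "Gsy_map f (Suc n) \<alpha> v = join (Suc n) \<beta> (\<lambda>\<gamma>\<in>Pow \<beta>. f (v \<gamma>), \<lambda>\<gamma>\<in>Pow \<beta>. f (v (insert (Suc n) \<gamma>)))"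
      using True by (auto simp: \<beta>_def[symmetric] G_map_def unjoin_def Suc.IH[OF \<beta>(3)]
        intro!: arg_cong[of _ _ "join (Suc n) \<beta>"] restrict_ext)
    also have "\<dots> = (\<lambda>\<gamma>\<in>Pow \<alpha>. f (v \<gamma>))"
    proof
      fix \<gamma>
      have "\<gamma> \<subseteq> \<beta>" if "\<gamma> \<subseteq> insert (Suc n) \<beta>" "Suc n \<notin> \<gamma>" using that by blast
      then show "join (Suc n) \<beta> (\<lambda>\<gamma>\<in>Pow \<beta>. f (v \<gamma>), \<lambda>\<gamma>\<in>Pow \<beta>. f (v (insert (Suc n) \<gamma>))) \<gamma>
          = (\<lambda>\<gamma>\<in>Pow \<alpha>. f (v \<gamma>)) \<gamma>"
        unfolding \<beta>(1) by (auto simp: join_def insert_absorb)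
    qed
    finally show ?thesis .
  next
    case False
    then have "\<alpha> \<subseteq> {1..n}" using Suc.prems by (auto simp: le_Suc_eq)
    with False Suc.IH show ?thesis by simp
  qed
qed

text \<open>Needed for \<open>flip\<close>, which coincides with the transposition acting on indices
  only at index sets inside \<open>{1, 2}\<close>.\<close>

lemma nfold_iso_cong:
  assumes "nfold_iso n C D F" "\<And>\<alpha>. \<alpha> \<subseteq> {1..n} \<Longrightarrow> F \<alpha> = F' \<alpha>"
  shows "nfold_iso n C D F'"
  unfolding nfold_iso_def
proof (intro conjI allI impI)
  fix \<beta> i assume "\<beta> \<subseteq> {1..n} \<and> i \<in> {1..n} - \<beta>"
  moreover from this have "F \<beta> = F' \<beta>" "F (insert i \<beta>) = F' (insert i \<beta>)"
    by (auto intro!: assms(2))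
  ultimately show "gpd_iso (edge C \<beta> (insert i \<beta>)) (edge D \<beta> (insert i \<beta>)) (F' \<beta>) (F' (insert i \<beta>))"
    using assms(1) by (metis nfold_iso_def)
qed (use assms in \<open>metis nfold_iso_def\<close>)

text \<open>HOL-Algebra reserves \<open>inv\<close> for inverses in a group.\<close>

abbreviation (input) pinv :: "('a \<Rightarrow> 'b) \<Rightarrow> 'b \<Rightarrow> 'a" where
  "pinv \<equiv> inv_into UNIV"

text \<open>Relabelling the vertices by \<open>\<tau>\<close> moves the permutation from the source
  to the target, where \<open>edge_symmetric\<close> expects it.\<close>

lemma nfold_iso_perm_swap:
  assumes iso: "nfold_iso n (nfold_perm (pinv \<tau>) C) D F" and \<tau>: "\<tau> permutes {1..n}"
  shows "nfold_iso n C (nfold_perm \<tau> D) (\<lambda>\<alpha>. F (\<tau> ` \<alpha>))"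
proof -
  have inv_im: "pinv \<tau> ` \<tau> ` \<alpha> = \<alpha>" for \<alpha>
    using permutes_inv_o(2)[OF \<tau>] by (simp add: image_image permutes_inverses(2)[OF \<tau>])
  have im: "\<tau> ` \<alpha> \<subseteq> {1..n}" if "\<alpha> \<subseteq> {1..n}" for \<alpha>
    using that permutes_image[OF \<tau>] by blast
  have mem: "\<tau> i \<in> {1..n} - \<tau> ` \<beta>" if "i \<in> {1..n} - \<beta>" for i \<beta>
    using that permutes_in_image[OF \<tau>] permutes_inj[OF \<tau>] by (auto dest: injD)
  show ?thesis
    unfolding nfold_iso_def
  proof (intro conjI allI impI)
    fix \<alpha> assume "\<alpha> \<subseteq> {1..n}"
    then show "bij_betw (F (\<tau> ` \<alpha>)) (vert C \<alpha>) (vert (nfold_perm \<tau> D) \<alpha>)"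
      using iso im[of \<alpha>] inv_im[of \<alpha>] by (auto simp: nfold_iso_def nfold_perm_def dest!: spec[of _ "\<tau> ` \<alpha>"])
  next
    fix \<beta> i assume "\<beta> \<subseteq> {1..n} \<and> i \<in> {1..n} - \<beta>"
    then have "\<tau> ` \<beta> \<subseteq> {1..n} \<and> \<tau> i \<in> {1..n} - \<tau> ` \<beta>"
      using im[of \<beta>] mem[of i \<beta>] by auto
    then have "gpd_iso (edge (nfold_perm (pinv \<tau>) C) (\<tau> ` \<beta>) (insert (\<tau> i) (\<tau> ` \<beta>)))
        (edge D (\<tau> ` \<beta>) (insert (\<tau> i) (\<tau> ` \<beta>))) (F (\<tau> ` \<beta>)) (F (insert (\<tau> i) (\<tau> ` \<beta>)))"
      by (rule iso[unfolded nfold_iso_def, THEN conjunct2, rule_format])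
    then show "gpd_iso (edge C \<beta> (insert i \<beta>)) (edge (nfold_perm \<tau> D) \<beta> (insert i \<beta>))
        (F (\<tau> ` \<beta>)) (F (\<tau> ` insert i \<beta>))"
      using inv_im[of \<beta>] inv_im[of "insert i \<beta>"] by (simp add: nfold_perm_def)
  qed
qed

text \<open>Precomposition with the image map of \<open>\<sigma>\<close>: a family over the image of
  \<open>\<alpha>\<close> is pulled back to \<open>\<alpha>\<close>. This is contravariant in
  \<open>\<sigma>\<close>, as \<open>perm_fam_comp\<close> records.\<close>

definition perm_fam :: "(nat \<Rightarrow> nat) \<Rightarrow> nat set \<Rightarrow> (nat set \<Rightarrow> 'v) \<Rightarrow> nat set \<Rightarrow> 'v" where
  "perm_fam \<sigma> \<alpha> v = (\<lambda>\<gamma>\<in>Pow \<alpha>. v (\<sigma> ` \<gamma>))"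

lemma perm_fam_apply: "\<gamma> \<subseteq> \<alpha> \<Longrightarrow> perm_fam \<sigma> \<alpha> v \<gamma> = v (\<sigma> ` \<gamma>)"
  by (simp add: perm_fam_def)

lemma perm_fam_fam: "v \<in> fam V (\<sigma> ` \<alpha>) \<Longrightarrow> perm_fam \<sigma> \<alpha> v \<in> fam V \<alpha>"
  by (auto simp: perm_fam_def PiE_iff intro!: image_mono)

lemma perm_fam_comp: "\<tau> ` \<beta> = \<alpha> \<Longrightarrow> perm_fam \<tau> \<beta> (perm_fam \<sigma> \<alpha> v) = perm_fam (\<sigma> \<circ> \<tau>) \<beta> v"
  by (rule ext) (auto simp: perm_fam_def image_comp restrict_def dest: image_mono[of _ _ \<tau>])

lemma perm_fam_id: "v \<in> fam V \<alpha> \<Longrightarrow> perm_fam id \<alpha> v = v"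
  by (rule fam_eqI[OF perm_fam_fam]) (simp_all add: perm_fam_apply)

section \<open>Projections onto the bottom vertex set\<close>

context gsy_data
begin

lemma vset_empty_iff:
  assumes "v \<in> fam V {}"
  shows "v \<in> vset K V t U {} \<longleftrightarrow> v {} \<in> U"
  using assms fam_mem[OF assms, of "{}"] by (simp add: vset_def xsum_empty)

text \<open>Along the path \<open>\<alpha>\<close> shrinks while \<open>\<beta>\<close> stays, so
  the induction needs the intersection of the two. By \<open>xsum_ftgt\<close> a target step
  accounts for the element \<open>i\<close> of the index of the sum; by \<open>xsum_fsrc\<close> a
  source step leaves the sum unchanged. The order of the list drops out.\<close>

lemma Gsy_topdown:
  "\<alpha> \<subseteq> {1..n} \<Longrightarrow> distinct ds \<Longrightarrow> set ds = \<alpha> \<Longrightarrow> v \<in> vset K V t U \<alpha> \<Longrightarrow>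
    topdown (Gsy V t U n) \<beta> \<alpha> ds v = pt (xsum K V t (\<beta> \<inter> \<alpha>) v)"
proof (induction ds arbitrary: \<alpha> v)
  case Nil
  then have v: "v \<in> fam V {}" by (auto dest: vset_fam)
  have "pt (v {}) = v"
    by (rule fam_eqI[OF _ v]) (use fam_mem[OF v, of "{}"] in \<open>auto simp: pt_def\<close>)
  with Nil fam_mem[OF v, of "{}"] show ?case by (simp add: xsum_empty)
next
  case (Cons i ds)
  define \<delta> where "\<delta> = set ds"
  have d: "\<alpha> = insert i \<delta>" "i \<notin> \<delta>" "\<alpha> - {i} = \<delta>" "insert i \<delta> \<subseteq> {1..n}" "\<delta> \<subseteq> {1..n}"
    using Cons.prems by (auto simp: \<delta>_def)
  have v: "v \<in> vset K V t U (insert i \<delta>)" using Cons.prems d by simp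
  note f = vset_fam[OF v] and G = Gsy_edge[OF le_refl d(4,2)]
  have IH: "topdown (Gsy V t U n) \<beta> \<delta> ds w = pt (xsum K V t (\<beta> \<inter> \<delta>) w)" if "w \<in> vset K V t U \<delta>" for w
    using Cons.IH[OF d(5) _ _ that] Cons.prems by (simp add: \<delta>_def)
  show ?case
  proof (cases "i \<in> \<beta>")
    case True
    have "topdown (Gsy V t U n) \<beta> \<alpha> (i # ds) v = topdown (Gsy V t U n) \<beta> \<delta> ds (ftgt V (t i) i \<delta> v)"
      using True G f by (simp add: d(1-3) fam_edge_def)
    also have "\<dots> = pt (xsum K V t (\<beta> \<inter> \<delta>) (ftgt V (t i) i \<delta> v))"
      by (rule IH[OF ftgt_vset[OF d(4,2) v]])
    also have "xsum K V t (\<beta> \<inter> \<delta>) (ftgt V (t i) i \<delta> v) = xsum K V t (insert i (\<beta> \<inter> \<delta>)) v"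
      by (rule xsum_ftgt[OF d(4,2) _ f]) simp
    also have "insert i (\<beta> \<inter> \<delta>) = \<beta> \<inter> \<alpha>" using True d by auto
    finally show ?thesis .
  next
    case False
    have "topdown (Gsy V t U n) \<beta> \<alpha> (i # ds) v = topdown (Gsy V t U n) \<beta> \<delta> ds (fsrc \<delta> v)"
      using False G f by (simp add: d(1-3) fam_edge_def)
    also have "\<dots> = pt (xsum K V t (\<beta> \<inter> \<delta>) (fsrc \<delta> v))"
      by (rule IH[OF fsrc_vset[OF d(4,2) v]])
    also have "xsum K V t (\<beta> \<inter> \<delta>) (fsrc \<delta> v) = xsum K V t (\<beta> \<inter> \<delta>) v"
      by (rule xsum_fsrc[OF d(5) _ f]) simp
    also have "\<beta> \<inter> \<delta> = \<beta> \<inter> \<alpha>" using False d by auto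
    finally show ?thesis .
  qed
qed

text \<open>The composite \<open>t \<circ> \<sigma>\<close> is kept opaque as \<open>s\<close>; the simplifier would unfold it.\<close>

context
  fixes \<sigma> :: "nat \<Rightarrow> nat" and s :: "nat \<Rightarrow> 'k"
  assumes \<sigma>: "\<sigma> permutes {1..n}" and s: "\<And>i. s i = t (\<sigma> i)"
begin

lemma perm_data: "gsy_data K V s U n"
proof
  show "s i \<in> carrier K" if "i \<in> {1..n}" for i
    using t_closed[of "\<sigma> i"] permutes_in_image[OF \<sigma>, of i] that s by simp
qed (rule U_sub)

interpretation P: gsy_data K V s U n
  by (rule perm_data)

lemma perm_image: "insert i \<beta> \<subseteq> {1..n} \<Longrightarrow> insert (\<sigma> i) (\<sigma> ` \<beta>) \<subseteq> {1..n}"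
  using permutes_image[OF \<sigma>] by blast

lemma perm_notin: "i \<notin> \<beta> \<Longrightarrow> \<sigma> i \<notin> \<sigma> ` \<beta>"
  using permutes_inj[OF \<sigma>] by (auto dest: injD)

text \<open>Injectivity of \<open>\<sigma>\<close> is what preserves the test for the direction in
  \<open>funit\<close> and \<open>fmul\<close>.\<close>

lemma perm_mem: "\<sigma> i \<in> \<sigma> ` \<gamma> \<longleftrightarrow> i \<in> \<gamma>"
  using permutes_inj[OF \<sigma>] by (auto dest: injD)

lemma fsrc_perm_fam: "fsrc \<beta> (perm_fam \<sigma> (insert i \<beta>) v) = perm_fam \<sigma> \<beta> (fsrc (\<sigma> ` \<beta>) v)"
  by (auto simp: fsrc_def perm_fam_def image_mono intro!: restrict_ext)

lemma ftgt_perm_fam: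
  "ftgt V a i \<beta> (perm_fam \<sigma> (insert i \<beta>) v) = perm_fam \<sigma> \<beta> (ftgt V a (\<sigma> i) (\<sigma> ` \<beta>) v)"
  by (auto simp: ftgt_def perm_fam_def image_mono intro!: restrict_ext)

lemma funit_perm_fam:
  "funit V i \<beta> (perm_fam \<sigma> \<beta> v) = perm_fam \<sigma> (insert i \<beta>) (funit V (\<sigma> i) (\<sigma> ` \<beta>) v)"
proof -
  have "\<sigma> ` \<gamma> \<subseteq> insert (\<sigma> i) (\<sigma> ` \<beta>)" if "\<gamma> \<subseteq> insert i \<beta>" for \<gamma>
    using that by blast
  then show ?thesis
    by (auto simp: funit_def perm_fam_def perm_mem subset_insert intro!: restrict_ext)
qed

lemma fmul_perm_fam:
  "fmul V i \<beta> (perm_fam \<sigma> (insert i \<beta>) w) (perm_fam \<sigma> (insert i \<beta>) v)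
    = perm_fam \<sigma> (insert i \<beta>) (fmul V (\<sigma> i) (\<sigma> ` \<beta>) w v)"
proof -
  have "\<sigma> ` \<gamma> \<subseteq> insert (\<sigma> i) (\<sigma> ` \<beta>)" if "\<gamma> \<subseteq> insert i \<beta>" for \<gamma>
    using that by blast
  then show ?thesis
    by (auto simp: fmul_def perm_fam_def perm_mem intro!: restrict_ext)
qed

text \<open>Removing one direction at a time with \<open>vset_insert\<close> avoids reindexing the
  sums over subsets and the products of parameters in them.\<close>

lemma vset_perm_fam:
  assumes "\<alpha> \<subseteq> {1..n}" "v \<in> fam V (\<sigma> ` \<alpha>)"
  shows "perm_fam \<sigma> \<alpha> v \<in> vset K V s U \<alpha> \<longleftrightarrow> v \<in> vset K V t U (\<sigma> ` \<alpha>)"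
proof -
  have "finite \<alpha>" using assms(1) by (rule finite_subset) simp
  then show ?thesis
    using assms
  proof (induction \<alpha> arbitrary: v rule: finite_induct)
    case empty
    then show ?case
      using P.vset_empty_iff[of "perm_fam \<sigma> {} v"] vset_empty_iff[of v] perm_fam_fam[where V = V and v = v and \<sigma> = \<sigma> and \<alpha> = "{}"]
        perm_fam_apply[of "{}" "{}" \<sigma> v]
      by (simp only: image_empty subset_refl)
  next
    case (insert i \<beta>)
    have v: "v \<in> fam V (insert (\<sigma> i) (\<sigma> ` \<beta>))" using insert.prems by simp
    note sub = perm_image[OF insert.prems(1)]
    have "fsrc (\<sigma> ` \<beta>) v \<in> fam V (\<sigma> ` \<beta>)" "ftgt V (t (\<sigma> i)) (\<sigma> i) (\<sigma> ` \<beta>) v \<in> fam V (\<sigma> ` \<beta>)"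
      using fsrc_fam[OF v] ftgt_fam[OF v t_closed_insert[OF sub]] by auto
    then show ?case
      using insert vset_insert[OF sub perm_notin[OF insert.hyps(2)], of v]
        P.vset_insert[OF insert.prems(1) insert.hyps(2), of "perm_fam \<sigma> (insert i \<beta>) v"]
        perm_fam_fam[OF insert.prems(2)] v
      by (simp add: fsrc_perm_fam ftgt_perm_fam s[of i])
  qed
qed

lemma bij_betw_perm_fam:
  assumes a: "\<alpha> \<subseteq> {1..n}"
  shows "bij_betw (perm_fam \<sigma> \<alpha>) (vset K V t U (\<sigma> ` \<alpha>)) (vset K V s U \<alpha>)"
proof -
  have i: "pinv \<sigma> ` \<sigma> ` \<alpha> = \<alpha>" "\<sigma> \<circ> pinv \<sigma> = id" "pinv \<sigma> \<circ> \<sigma> = id"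
    using permutes_inv_o[OF \<sigma>] by (simp_all add: image_comp)
  have c1: "perm_fam (pinv \<sigma>) (\<sigma> ` \<alpha>) (perm_fam \<sigma> \<alpha> v) = v" if "v \<in> fam V (\<sigma> ` \<alpha>)" for v
    using that by (simp add: perm_fam_comp i perm_fam_id)
  have c2: "perm_fam \<sigma> \<alpha> (perm_fam (pinv \<sigma>) (\<sigma> ` \<alpha>) v) = v" if "v \<in> fam V \<alpha>" for v
    using that by (simp add: perm_fam_comp i perm_fam_id)
  have f: "perm_fam (pinv \<sigma>) (\<sigma> ` \<alpha>) v \<in> fam V (\<sigma> ` \<alpha>)" if "v \<in> fam V \<alpha>" for v
    using perm_fam_fam[where V = V and v = v and \<sigma> = "pinv \<sigma>" and \<alpha> = "\<sigma> ` \<alpha>"] that i by simp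
  show ?thesis
  proof (rule bij_betwI[where g = "perm_fam (pinv \<sigma>) (\<sigma> ` \<alpha>)"])
    show "perm_fam \<sigma> \<alpha> \<in> vset K V t U (\<sigma> ` \<alpha>) \<rightarrow> vset K V s U \<alpha>"
      using vset_perm_fam[OF a] vset_fam by blast
    show "perm_fam (pinv \<sigma>) (\<sigma> ` \<alpha>) \<in> vset K V s U \<alpha> \<rightarrow> vset K V t U (\<sigma> ` \<alpha>)"
    proof
      \<comment> \<open>By \<open>c2\<close>, \<open>v\<close> is the image of its pullback along
        the inverse; so \<open>vset_perm_fam\<close>, read from left to right, places that pullback
        in the vertex set.\<close>
      fix v assume v: "v \<in> vset K V s U \<alpha>"
      then have "v \<in> fam V \<alpha>" by (rule P.vset_fam)
      with v vset_perm_fam[OF a f] c2 show "perm_fam (pinv \<sigma>) (\<sigma> ` \<alpha>) v \<in> vset K V t U (\<sigma> ` \<alpha>)"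
        by metis
    qed
  qed (use c1 c2 vset_fam P.vset_fam in blast)+
qed

text \<open>Direction \<open>i\<close> of the permuted source is the original direction
  \<open>\<sigma> i\<close>, whose parameter \<open>t (\<sigma> i)\<close> is \<open>s i\<close>.
  Hence the target maps on both sides use the same scalar.\<close>

lemma Gsy_perm_iso: "nfold_iso n (nfold_perm \<sigma> (Gsy V t U n)) (Gsy V s U n) (perm_fam \<sigma>)"
  unfolding nfold_iso_def
proof (intro conjI allI impI; (elim conjE)?)
  fix \<alpha> assume a: "\<alpha> \<subseteq> {1..n}"
  then have "\<sigma> ` \<alpha> \<subseteq> {1..n}" using permutes_image[OF \<sigma>] by blast
  with a bij_betw_perm_fam[OF a]
  show "bij_betw (perm_fam \<sigma> \<alpha>) (vert (nfold_perm \<sigma> (Gsy V t U n)) \<alpha>) (vert (Gsy V s U n) \<alpha>)"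
    by (simp add: nfold_perm_def Gsy_vert P.Gsy_vert)
next
  fix \<beta> i assume "\<beta> \<subseteq> {1..n}" "i \<in> {1..n} - \<beta>"
  then have sub: "insert i \<beta> \<subseteq> {1..n}" "i \<notin> \<beta>" "\<beta> \<subseteq> {1..n}" by auto
  define G where "G = edge (nfold_perm \<sigma> (Gsy V t U n)) \<beta> (insert i \<beta>)"
  define H where "H = edge (Gsy V s U n) \<beta> (insert i \<beta>)"
  note sub' = perm_image[OF sub(1)] perm_notin[OF sub(2)]
  have G: "fam_edge K V t U (\<sigma> i) (\<sigma> ` \<beta>) G"
    using Gsy_edge[OF le_refl sub'] by (simp add: G_def nfold_perm_def)
  have H: "fam_edge K V s U i \<beta> H"
    unfolding H_def by (rule P.Gsy_edge[OF le_refl sub(1,2)])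
  note G' = G[unfolded fam_edge_def] and H' = H[unfolded fam_edge_def]
  have b: "bij_betw (perm_fam \<sigma> \<beta>) (gobj G) (gobj H)"
    and b': "bij_betw (perm_fam \<sigma> (insert i \<beta>)) (gmor G) (gmor H)"
    using bij_betw_perm_fam[OF sub(3)] bij_betw_perm_fam[OF sub(1)] G' H' by simp_all
  have f: "perm_fam \<sigma> (insert i \<beta>) v \<in> fam V (insert i \<beta>)" if "v \<in> fam V (insert (\<sigma> i) (\<sigma> ` \<beta>))" for v
    using perm_fam_fam[where V = V and v = v and \<sigma> = \<sigma> and \<alpha> = "insert i \<beta>"] that by simp
  show "gpd_iso G H (perm_fam \<sigma> \<beta>) (perm_fam \<sigma> (insert i \<beta>))"
    unfolding gpd_iso_def gpd_hom_def
  proof (intro conjI ballI allI impI b b' bij_betw_imp_funcset[OF b] bij_betw_imp_funcset[OF b'])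
    fix v assume "v \<in> gmor G"
    then have "v \<in> fam V (insert (\<sigma> i) (\<sigma> ` \<beta>))" using G' vset_fam by simp
    then show "gsrc H (perm_fam \<sigma> (insert i \<beta>) v) = perm_fam \<sigma> \<beta> (gsrc G v)"
      "gtgt H (perm_fam \<sigma> (insert i \<beta>) v) = perm_fam \<sigma> \<beta> (gtgt G v)"
      using G' H' by (simp_all add: s f fsrc_perm_fam ftgt_perm_fam)
  next
    fix v assume "v \<in> gobj G"
    then have "v \<in> fam V (\<sigma> ` \<beta>)" using G' vset_fam by simp
    then show "gunit H (perm_fam \<sigma> \<beta> v) = perm_fam \<sigma> (insert i \<beta>) (gunit G v)"
      using G' H' by (simp add: perm_fam_fam funit_perm_fam)
  next
    fix w v assume "composable G w v"
    note c = fam_edge_composable[OF G this]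
    then show "perm_fam \<sigma> (insert i \<beta>) (gcomp G w v)
        = gcomp H (perm_fam \<sigma> (insert i \<beta>) w) (perm_fam \<sigma> (insert i \<beta>) v)"
      using H' by (simp add: f fmul_perm_fam)
  qed
qed

end

lemma Gsy_edge_symmetric:
  assumes eq: "\<forall>i\<in>{1..n}. \<forall>j\<in>{1..n}. t i = t j"
  shows "edge_symmetric n (Gsy V t U n)"
  unfolding edge_symmetric_def
\<comment> \<open>The map at \<open>\<tau>\<close> has to lead from \<open>\<alpha>\<close> to its
  image under \<open>\<tau>\<close>, so an index in the image is read at its preimage. The inverse
  also cancels the contravariance of \<open>perm_fam\<close>, which gives the action law in the
  required order.\<close>
proof (intro conjI exI[of _ "\<lambda>\<tau> \<alpha>. perm_fam (pinv \<tau>) (\<tau> ` \<alpha>)"] allI impI ballI)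
  show "nfold_groupoid n (Gsy V t U n)" by (rule Gsy_nfold_groupoid)
next
  fix \<tau> assume \<tau>: "\<tau> permutes {1..n}"
  have "t ((pinv \<tau>) i) = t i" if "i \<in> {1..n}" for i
    using eq that permutes_in_image[OF permutes_inv[OF \<tau>], of i] by blast
  then have "Gsy V (t \<circ> pinv \<tau>) U n = Gsy V t U n"
    by (intro Gsy_cong) simp
  with Gsy_perm_iso[OF permutes_inv[OF \<tau>], of "t \<circ> pinv \<tau>"]
  have "nfold_iso n (nfold_perm (pinv \<tau>) (Gsy V t U n)) (Gsy V t U n) (perm_fam (pinv \<tau>))" by simp
  then show "nfold_iso n (Gsy V t U n) (nfold_perm \<tau> (Gsy V t U n)) (\<lambda>\<alpha>. perm_fam (pinv \<tau>) (\<tau> ` \<alpha>))"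
    using \<tau> by (rule nfold_iso_perm_swap)
next
  fix \<alpha> v assume "\<alpha> \<subseteq> {1..n}" "v \<in> vert (Gsy V t U n) \<alpha>"
  then have "v \<in> fam V \<alpha>" using vset_fam by (simp add: Gsy_vert)
  then show "perm_fam (pinv id) (id ` \<alpha>) v = v" by (simp add: perm_fam_id)
next
  fix \<sigma> \<tau> \<alpha> v
  assume "\<sigma> permutes {1..n} \<and> \<tau> permutes {1..n} \<and> \<alpha> \<subseteq> {1..n}"
  then have p: "\<sigma> permutes {1..n}" "\<tau> permutes {1..n}" by auto
  \<comment> \<open>This is the matching of index sets that \<open>perm_fam_comp\<close> demands for
    the two successive pullbacks.\<close>
  have "pinv \<sigma> ` (\<sigma> ` \<tau> ` \<alpha>) = \<tau> ` \<alpha>"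
    by (simp add: image_image permutes_inverses(2)[OF p(1)])
  then show "perm_fam (pinv (\<sigma> \<circ> \<tau>)) ((\<sigma> \<circ> \<tau>) ` \<alpha>) v
      = perm_fam (pinv \<sigma>) (\<sigma> ` \<tau> ` \<alpha>) (perm_fam (pinv \<tau>) (\<tau> ` \<alpha>) v)"
    using p by (simp add: perm_fam_comp o_inv_distrib permutes_bij image_comp)
qed

end

section \<open>The flip for two directions\<close>

lemma flip_eq_perm_fam:
  assumes "\<alpha> \<subseteq> {1..2}"
  shows "flip \<alpha> = perm_fam (Transposition.transpose 1 2) \<alpha>"
proof
  fix v :: "nat set \<Rightarrow> 'v"
  have "{1..2} = {1, 2 :: nat}" by auto
  moreover have "Pow {1, 2 :: nat} = {{}, {1}, {2}, {1, 2}}" by (auto simp: Pow_insert)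
  ultimately have c: "\<gamma> \<in> {{}, {1}, {2}, {1, 2}}" if "\<gamma> \<subseteq> \<alpha>" for \<gamma>
    using subset_trans[OF that assms] by (metis PowI)
  show "flip \<alpha> v = perm_fam (Transposition.transpose 1 2) \<alpha> v"
    unfolding flip_def perm_fam_def
  proof (rule restrict_ext)
    fix \<gamma> assume "\<gamma> \<in> Pow \<alpha>"
    then have "\<gamma> = {} \<or> \<gamma> = {1} \<or> \<gamma> = {2} \<or> \<gamma> = {1, 2}" using c[of \<gamma>] by simp
    then show "(if \<gamma> = {1} then v {2} else if \<gamma> = {2} then v {1} else v \<gamma>)
        = v (Transposition.transpose 1 2 ` \<gamma>)"
      by (elim disjE) (simp_all add: insert_commute doubleton_eq_iff)
  qed
qed

lemma Gsy_flip_iso: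
  assumes "module K V" "U \<subseteq> carrier V" "t1 \<in> carrier K" "t2 \<in> carrier K"
  shows "nfold_iso 2 (nfold_perm (Transposition.transpose 1 2) (Gsy V (params2 t1 t2) U 2))
    (Gsy V (params2 t2 t1) U 2) flip"
proof -
  have d: "gsy_data K V (params2 t1 t2) U 2"
    using assms by (simp add: gsy_data_def gsy_data_axioms_def params2_def)
  have p: "Transposition.transpose 1 2 permutes {1..2::nat}"
    by (rule permutes_swap_id) simp_all
  have "{1..2} = {1, 2 :: nat}" by auto
  then have "Gsy V (params2 t1 t2 \<circ> Transposition.transpose 1 2) U 2 = Gsy V (params2 t2 t1) U 2"
    by (intro Gsy_cong) (auto simp: params2_def)
  with gsy_data.Gsy_perm_iso[OF d p, of "params2 t1 t2 \<circ> Transposition.transpose 1 2"]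
  have "nfold_iso 2 (nfold_perm (Transposition.transpose 1 2) (Gsy V (params2 t1 t2) U 2))
    (Gsy V (params2 t2 t1) U 2) (perm_fam (Transposition.transpose 1 2))"
    by simp
  then show ?thesis
    by (rule nfold_iso_cong) (rule flip_eq_perm_fam[symmetric])
qed

section \<open>Products\<close>

text \<open>Stated with projections, so that the rules apply to an entry of a family, which is not
  syntactically a pair.\<close>

lemma module_prod_simps [simp]:
  "carrier (module_prod V W) = carrier V \<times> carrier W"
  "\<zero>\<^bsub>module_prod V W\<^esub> = (\<zero>\<^bsub>V\<^esub>, \<zero>\<^bsub>W\<^esub>)"
  "x \<oplus>\<^bsub>module_prod V W\<^esub> y = (fst x \<oplus>\<^bsub>V\<^esub> fst y, snd x \<oplus>\<^bsub>W\<^esub> snd y)"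
  "a \<odot>\<^bsub>module_prod V W\<^esub> x = (a \<odot>\<^bsub>V\<^esub> fst x, a \<odot>\<^bsub>W\<^esub> snd x)"
  by (simp_all add: module_prod_def split_beta)

lemma module_module_prod:
  assumes "module K V" "module K W"
  shows "module K (module_prod V W)"
proof -
  interpret V: module K V by fact
  interpret W: module K W by fact
  have "abelian_group (module_prod V W)"
  proof (rule abelian_groupI)
    fix x assume "x \<in> carrier (module_prod V W)"
    then show "\<exists>y\<in>carrier (module_prod V W). y \<oplus>\<^bsub>module_prod V W\<^esub> x = \<zero>\<^bsub>module_prod V W\<^esub>"
      by (intro bexI[of _ "(\<ominus>\<^bsub>V\<^esub> fst x, \<ominus>\<^bsub>W\<^esub> snd x)"]) (auto simp: V.M.l_neg W.M.l_neg)
  qed (auto simp: V.M.a_ac W.M.a_ac)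
  then show ?thesis
    by (intro moduleI) (auto simp: V.R.cring_axioms V.smult_l_distr V.smult_r_distr V.smult_assoc1
      W.smult_l_distr W.smult_r_distr W.smult_assoc1 V.is_cring)
qed

lemma unzip_fam:
  assumes "z \<in> fam (module_prod V W) \<alpha>"
  shows "fst (unzip \<alpha> z) \<in> fam V \<alpha>" "snd (unzip \<alpha> z) \<in> fam W \<alpha>"
proof -
  have "z \<gamma> \<in> carrier V \<times> carrier W" if "\<gamma> \<subseteq> \<alpha>" for \<gamma>
    using assms that by (simp add: PiE_iff)
  then show "fst (unzip \<alpha> z) \<in> fam V \<alpha>" "snd (unzip \<alpha> z) \<in> fam W \<alpha>"
    by (auto simp: unzip_def mem_Times_iff)
qed

lemma unzip_fsrc: "unzip \<beta> (fsrc \<beta> z) = map_prod (fsrc \<beta>) (fsrc \<beta>) (unzip (insert i \<beta>) z)"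
  by (auto simp: unzip_def fsrc_def intro!: restrict_ext)

lemma unzip_ftgt:
  "unzip \<beta> (ftgt (module_prod V W) a i \<beta> z) = map_prod (ftgt V a i \<beta>) (ftgt W a i \<beta>) (unzip (insert i \<beta>) z)"
  by (auto simp: unzip_def ftgt_def intro!: restrict_ext)

lemma unzip_funit:
  "unzip (insert i \<beta>) (funit (module_prod V W) i \<beta> z) = map_prod (funit V i \<beta>) (funit W i \<beta>) (unzip \<beta> z)"
  by (auto simp: unzip_def funit_def subset_insert intro!: restrict_ext)

lemma unzip_fmul:
  "unzip (insert i \<beta>) (fmul (module_prod V W) i \<beta> y z)
    = (fmul V i \<beta> (fst (unzip (insert i \<beta>) y)) (fst (unzip (insert i \<beta>) z)),
       fmul W i \<beta> (snd (unzip (insert i \<beta>) y)) (snd (unzip (insert i \<beta>) z)))"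
  by (auto simp: unzip_def fmul_def intro!: restrict_ext)

lemma bij_betw_unzip_fam: "bij_betw (unzip \<alpha>) (fam (module_prod V W) \<alpha>) (fam V \<alpha> \<times> fam W \<alpha>)"
proof (rule bij_betwI[where g = "\<lambda>(v, w). \<lambda>\<gamma>\<in>Pow \<alpha>. (v \<gamma>, w \<gamma>)"])
  show "unzip \<alpha> \<in> fam (module_prod V W) \<alpha> \<rightarrow> fam V \<alpha> \<times> fam W \<alpha>"
    using unzip_fam[where V = V and W = W] by (auto simp: mem_Times_iff)
  show "(\<lambda>(v, w). \<lambda>\<gamma>\<in>Pow \<alpha>. (v \<gamma>, w \<gamma>)) \<in> fam V \<alpha> \<times> fam W \<alpha> \<rightarrow> fam (module_prod V W) \<alpha>"
  proof
    fix y assume "y \<in> fam V \<alpha> \<times> fam W \<alpha>"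
    then have "fst y \<gamma> \<in> carrier V" "snd y \<gamma> \<in> carrier W" if "\<gamma> \<subseteq> \<alpha>" for \<gamma>
      using that by (auto simp: PiE_iff)
    then show "(case y of (v, w) \<Rightarrow> \<lambda>\<gamma>\<in>Pow \<alpha>. (v \<gamma>, w \<gamma>)) \<in> fam (module_prod V W) \<alpha>"
      by (simp add: split_beta restrict_PiE_iff)
  qed
next
  fix z assume "z \<in> fam (module_prod V W) \<alpha>"
  then show "(case unzip \<alpha> z of (v, w) \<Rightarrow> \<lambda>\<gamma>\<in>Pow \<alpha>. (v \<gamma>, w \<gamma>)) = z"
    by (intro fam_eqI[where V = "module_prod V W" and \<alpha> = \<alpha>]) (auto simp: unzip_def PiE_iff)
next
  fix y assume "y \<in> fam V \<alpha> \<times> fam W \<alpha>"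
  then show "unzip \<alpha> (case y of (v, w) \<Rightarrow> \<lambda>\<gamma>\<in>Pow \<alpha>. (v \<gamma>, w \<gamma>)) = y"
    by (auto simp: unzip_def PiE_iff extensional_def restrict_def)
qed

text \<open>Both factors share \<open>K\<close>, \<open>t\<close> and \<open>n\<close>, so that the
  product module is again an instance of \<open>gsy_data\<close> with the same parameters.\<close>

locale gsy_data_pair = V: gsy_data K V t U n + W: gsy_data K W t U' n
  for K :: "('k, 'r) ring_scheme" and V :: "('k, 'v, 'y) module_scheme"
    and W :: "('k, 'w, 'z) module_scheme" and t U U' n
begin

lemma prod_data: "gsy_data K (module_prod V W) t (U \<times> U') n"
  using V.U_sub W.U_sub V.t_closed module_module_prod[OF V.module_axioms W.module_axioms]
  by (auto simp: gsy_data_def gsy_data_axioms_def)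

interpretation P: gsy_data K "module_prod V W" t "U \<times> U'" n
  by (rule prod_data)

text \<open>\<open>unzip\<close> commutes with sources and targets, so removing one direction at a
  time reduces the claim to single entries; no finite sum in the product module has to be
  split.\<close>

lemma vset_unzip:
  assumes "\<alpha> \<subseteq> {1..n}" "z \<in> fam (module_prod V W) \<alpha>"
  shows "z \<in> vset K (module_prod V W) t (U \<times> U') \<alpha> \<longleftrightarrow>
    unzip \<alpha> z \<in> vset K V t U \<alpha> \<times> vset K W t U' \<alpha>"
proof -
  have "finite \<alpha>" using assms(1) by (rule finite_subset) simp
  then show ?thesis
    using assms
  proof (induction \<alpha> arbitrary: z rule: finite_induct)
    case empty
    have "z \<in> vset K (module_prod V W) t (U \<times> U') {} \<longleftrightarrow> z {} \<in> U \<times> U'"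
      by (rule P.vset_empty_iff[OF empty.prems(2)])
    moreover have "fst (unzip {} z) \<in> vset K V t U {} \<longleftrightarrow> fst (z {}) \<in> U"
      using V.vset_empty_iff[OF unzip_fam(1)[OF empty.prems(2)]] by (simp add: unzip_def)
    moreover have "snd (unzip {} z) \<in> vset K W t U' {} \<longleftrightarrow> snd (z {}) \<in> U'"
      using W.vset_empty_iff[OF unzip_fam(2)[OF empty.prems(2)]] by (simp add: unzip_def)
    ultimately show ?case by (simp only: mem_Times_iff)
  next
    case (insert i \<beta>)
    note z = insert.prems(2) and sub = insert.prems(1)
    have "\<beta> \<subseteq> {1..n}" using sub by simp
    note IH = insert.IH[OF this P.fsrc_fam[OF z]] insert.IH[OF this P.ftgt_fam[OF z P.t_closed_insert[OF sub]]]
    show ?case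
      unfolding P.vset_insert[OF sub insert.hyps(2)] mem_Times_iff V.vset_insert[OF sub insert.hyps(2)]
        W.vset_insert[OF sub insert.hyps(2)] IH unzip_fsrc[of \<beta> z i] unzip_ftgt
      using z unzip_fam[OF z] by (simp only: fst_map_prod snd_map_prod) meson
  qed
qed

text \<open>Obtained by restricting the bijection on all families: \<open>vset_unzip\<close> says
  that it matches the vertex sets.\<close>

lemma bij_betw_unzip:
  assumes a: "\<alpha> \<subseteq> {1..n}"
  shows "bij_betw (unzip \<alpha>) (vset K (module_prod V W) t (U \<times> U') \<alpha>) (vset K V t U \<alpha> \<times> vset K W t U' \<alpha>)"
proof (rule bij_betw_subset[OF bij_betw_unzip_fam])
  show "vset K (module_prod V W) t (U \<times> U') \<alpha> \<subseteq> fam (module_prod V W) \<alpha>"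
    using P.vset_fam by blast
  show "unzip \<alpha> ` vset K (module_prod V W) t (U \<times> U') \<alpha> = vset K V t U \<alpha> \<times> vset K W t U' \<alpha>"
  proof (intro subset_antisym subsetI)
    fix y assume "y \<in> unzip \<alpha> ` vset K (module_prod V W) t (U \<times> U') \<alpha>"
    then show "y \<in> vset K V t U \<alpha> \<times> vset K W t U' \<alpha>"
      using vset_unzip[OF a] P.vset_fam by blast
  next
    fix y assume y: "y \<in> vset K V t U \<alpha> \<times> vset K W t U' \<alpha>"
    then have "y \<in> fam V \<alpha> \<times> fam W \<alpha>"
      using V.vset_fam[of "fst y"] W.vset_fam[of "snd y"] by (simp add: mem_Times_iff)
    then have "y \<in> unzip \<alpha> ` fam (module_prod V W) \<alpha>"
      by (simp only: bij_betw_imp_surj_on[OF bij_betw_unzip_fam[of \<alpha> V W]])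
    then obtain z where z: "y = unzip \<alpha> z" "z \<in> fam (module_prod V W) \<alpha>" by (rule imageE)
    with y have "z \<in> vset K (module_prod V W) t (U \<times> U') \<alpha>"
      by (simp only: vset_unzip[OF a z(2)])
    with z(1) show "y \<in> unzip \<alpha> ` vset K (module_prod V W) t (U \<times> U') \<alpha>"
      by (rule image_eqI)
  qed
qed

lemma Gsy_prod_iso:
  "nfold_iso n (Gsy (module_prod V W) t (U \<times> U') n) (nfold_prod (Gsy V t U n) (Gsy W t U' n)) unzip"
  unfolding nfold_iso_def
proof (intro conjI allI impI; (elim conjE)?)
  fix \<alpha> assume a: "\<alpha> \<subseteq> {1..n}"
  with bij_betw_unzip[OF a]
  show "bij_betw (unzip \<alpha>) (vert (Gsy (module_prod V W) t (U \<times> U') n) \<alpha>)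
      (vert (nfold_prod (Gsy V t U n) (Gsy W t U' n)) \<alpha>)"
    by (simp add: nfold_prod_def P.Gsy_vert V.Gsy_vert W.Gsy_vert)
next
  fix \<beta> i assume "\<beta> \<subseteq> {1..n}" "i \<in> {1..n} - \<beta>"
  then have sub: "insert i \<beta> \<subseteq> {1..n}" "i \<notin> \<beta>" "\<beta> \<subseteq> {1..n}" by auto
  define G where "G = edge (Gsy (module_prod V W) t (U \<times> U') n) \<beta> (insert i \<beta>)"
  define H1 where "H1 = edge (Gsy V t U n) \<beta> (insert i \<beta>)"
  define H2 where "H2 = edge (Gsy W t U' n) \<beta> (insert i \<beta>)"
  define H where "H = edge (nfold_prod (Gsy V t U n) (Gsy W t U' n)) \<beta> (insert i \<beta>)"
  have H: "H = gpd_prod H1 H2" by (simp add: H_def H1_def H2_def nfold_prod_def)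
  have G: "fam_edge K (module_prod V W) t (U \<times> U') i \<beta> G"
    unfolding G_def by (rule P.Gsy_edge[OF le_refl sub(1,2)])
  have E1: "fam_edge K V t U i \<beta> H1"
    unfolding H1_def by (rule V.Gsy_edge[OF le_refl sub(1,2)])
  have E2: "fam_edge K W t U' i \<beta> H2"
    unfolding H2_def by (rule W.Gsy_edge[OF le_refl sub(1,2)])
  note G' = G[unfolded fam_edge_def] and E1' = E1[unfolded fam_edge_def] and E2' = E2[unfolded fam_edge_def]
  have b: "bij_betw (unzip \<beta>) (gobj G) (gobj H)"
    and b': "bij_betw (unzip (insert i \<beta>)) (gmor G) (gmor H)"
    using bij_betw_unzip[OF sub(3)] bij_betw_unzip[OF sub(1)] G' E1' E2'
    by (simp_all add: H gpd_prod_def)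
  note eqs = H gpd_prod_def map_prod_def split_beta
  show "gpd_iso G H (unzip \<beta>) (unzip (insert i \<beta>))"
    unfolding gpd_iso_def gpd_hom_def
  proof (intro conjI ballI allI impI b b' bij_betw_imp_funcset[OF b] bij_betw_imp_funcset[OF b'])
    fix z assume "z \<in> gmor G"
    then have z: "z \<in> fam (module_prod V W) (insert i \<beta>)" using G' P.vset_fam by simp
    show "gsrc H (unzip (insert i \<beta>) z) = unzip \<beta> (gsrc G z)"
      "gtgt H (unzip (insert i \<beta>) z) = unzip \<beta> (gtgt G z)"
      using z unzip_fam[OF z] G' E1' E2' by (simp_all add: eqs unzip_fsrc[of \<beta> z i] unzip_ftgt)
  next
    fix z assume "z \<in> gobj G"
    then have z: "z \<in> fam (module_prod V W) \<beta>" using G' P.vset_fam by simp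
    show "gunit H (unzip \<beta> z) = unzip (insert i \<beta>) (gunit G z)"
      using z unzip_fam[OF z] G' E1' E2' by (simp add: eqs unzip_funit)
  next
    fix y z assume "composable G y z"
    note c = P.fam_edge_composable[OF G this]
    show "unzip (insert i \<beta>) (gcomp G y z) = gcomp H (unzip (insert i \<beta>) y) (unzip (insert i \<beta>) z)"
      using c unzip_fam[OF c(3)] unzip_fam[OF c(4)] E1' E2' by (simp add: eqs unzip_fmul)
  qed
qed

end

text \<open>This is the naturality of the product isomorphism: on either side \<open>f\<close> and
  \<open>g\<close> act entry by entry.\<close>

lemma unzip_Gsy_map:
  assumes "\<alpha> \<subseteq> {1..n}"
  shows "unzip \<alpha> (Gsy_map (map_prod f g) n \<alpha> z) = map_prod (Gsy_map f n \<alpha>) (Gsy_map g n \<alpha>) (unzip \<alpha> z)"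
  using assms by (auto simp: Gsy_map_apply unzip_def intro!: restrict_ext)

section \<open>Assembly of the structure theorem\<close>

theorem theorem4p3:
  fixes K :: "('k, 'r) ring_scheme" and V :: "('k, 'v, 'z) module_scheme" and U :: "'v set"
    and n :: nat and t :: "nat \<Rightarrow> 'k"
  assumes "cring K" and "linear_set K V U" and "\<forall>i\<in>{1..n}. t i \<in> carrier K"
  shows
    "nfold_groupoid n (Gsy V t U n) \<and>

     (\<forall>\<alpha>. \<alpha> \<subseteq> {1..n} \<longrightarrow>
        vert (Gsy V t U n) \<alpha> = {v \<in> Pow \<alpha> \<rightarrow>\<^sub>E carrier V. \<forall>\<beta>. \<beta> \<subseteq> \<alpha> \<longrightarrow> xsum K V t \<beta> v \<in> U}) \<and>
     vert (Gsy V t U n) {} = pt ` U \<and>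

     (\<forall>\<beta> i. \<beta> \<subseteq> {1..n} \<and> i \<in> {1..n} - \<beta> \<longrightarrow>
        (let \<alpha> = insert i \<beta>; C = Gsy V t U n; G = edge C \<beta> \<alpha> in
          (\<forall>v\<in>vert C \<alpha>. gsrc G v = (\<lambda>\<gamma>\<in>Pow \<beta>. v \<gamma>)) \<and>
          (\<forall>v\<in>vert C \<alpha>. gtgt G v = (\<lambda>\<gamma>\<in>Pow \<beta>. v \<gamma> \<oplus>\<^bsub>V\<^esub> t i \<odot>\<^bsub>V\<^esub> v (insert i \<gamma>))) \<and>
          (\<forall>v\<in>vert C \<beta>. gunit G v = (\<lambda>\<gamma>\<in>Pow \<alpha>. if i \<in> \<gamma> then \<zero>\<^bsub>V\<^esub> else v \<gamma>)) \<and>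
          (\<forall>v' v. composable G v' v \<longrightarrow>
             gcomp G v' v \<in> Pow \<alpha> \<rightarrow>\<^sub>E carrier V \<and>
             (\<forall>\<gamma>. \<gamma> \<subseteq> \<beta> \<longrightarrow> gcomp G v' v \<gamma> = v \<gamma> \<and>
                gcomp G v' v (insert i \<gamma>) = v (insert i \<gamma>) \<oplus>\<^bsub>V\<^esub> v' (insert i \<gamma>))))) \<and>

     (\<forall>\<alpha> \<beta> ds. \<alpha> \<subseteq> {1..n} \<and> \<beta> \<subseteq> \<alpha> \<and> distinct ds \<and> set ds = \<alpha> \<longrightarrow>
        (\<forall>v\<in>vert (Gsy V t U n) \<alpha>.
           topdown (Gsy V t U n) \<beta> \<alpha> ds v = pt (xsum K V t \<beta> v) \<and> xsum K V t \<beta> v \<in> U)) \<and>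

     (\<forall>t1\<in>carrier K. \<forall>t2\<in>carrier K.
        nfold_iso 2 (nfold_perm (Transposition.transpose 1 2) (Gsy V (params2 t1 t2) U 2))
          (Gsy V (params2 t2 t1) U 2) flip \<and>
        (t1 = t2 \<longrightarrow> edge_symmetric 2 (Gsy V (params2 t1 t2) U 2))) \<and>

     (\<forall>\<sigma>. \<sigma> permutes {1..n} \<longrightarrow>
        nfold_iso n (nfold_perm \<sigma> (Gsy V t U n)) (Gsy V (t \<circ> \<sigma>) U n)
          (\<lambda>\<alpha> v. \<lambda>\<gamma>\<in>Pow \<alpha>. v (\<sigma> ` \<gamma>))) \<and>
     ((\<forall>i\<in>{1..n}. \<forall>j\<in>{1..n}. t i = t j) \<longrightarrow> edge_symmetric n (Gsy V t U n)) \<and>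

     (\<forall>(W :: ('k, 'w, 'y) module_scheme) U'. linear_set K W U' \<longrightarrow>
        nfold_iso n (Gsy (module_prod V W) t (U \<times> U') n)
          (nfold_prod (Gsy V t U n) (Gsy W t U' n)) unzip \<and>
        (\<forall>(V1 :: ('k, 'v1, 'z1) module_scheme) U1 (W1 :: ('k, 'w1, 'y1) module_scheme) U1' f g.
           linear_set K V1 U1 \<and> linear_set K W1 U1' \<and>
           linear_set_hom K V U V1 U1 f \<and> linear_set_hom K W U' W1 U1' g \<longrightarrow>
           (\<forall>\<alpha>. \<alpha> \<subseteq> {1..n} \<longrightarrow> (\<forall>z\<in>vert (Gsy (module_prod V W) t (U \<times> U') n) \<alpha>.
              unzip \<alpha> (Gsy_map (map_prod f g) n \<alpha> z)
                = map_prod (Gsy_map f n \<alpha>) (Gsy_map g n \<alpha>) (unzip \<alpha> z)))))"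
proof -
  interpret gsy_data K V t U n
    using assms by (simp add: gsy_data_def gsy_data_axioms_def linear_set_def)
  have vert: "vert (Gsy V t U n) \<alpha> = vset K V t U \<alpha>" if "\<alpha> \<subseteq> {1..n}" for \<alpha>
    using that by (simp add: Gsy_vert)
  have xU: "xsum K V t \<beta> v \<in> U" if "\<beta> \<subseteq> \<alpha>" "v \<in> vset K V t U \<alpha>" for \<alpha> \<beta> v
    using that by (simp add: vset_def)
  show ?thesis
  proof (intro conjI)
    show "nfold_groupoid n (Gsy V t U n)" by (rule Gsy_nfold_groupoid)
    show "\<forall>\<alpha>. \<alpha> \<subseteq> {1..n} \<longrightarrow>
        vert (Gsy V t U n) \<alpha> = {v \<in> Pow \<alpha> \<rightarrow>\<^sub>E carrier V. \<forall>\<beta>. \<beta> \<subseteq> \<alpha> \<longrightarrow> xsum K V t \<beta> v \<in> U}"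
      using vert by (simp add: vset_def)
    show "vert (Gsy V t U n) {} = pt ` U" by (simp add: vert vset_empty)
    show "\<forall>\<beta> i. \<beta> \<subseteq> {1..n} \<and> i \<in> {1..n} - \<beta> \<longrightarrow>
        (let \<alpha> = insert i \<beta>; C = Gsy V t U n; G = edge C \<beta> \<alpha> in
          (\<forall>v\<in>vert C \<alpha>. gsrc G v = (\<lambda>\<gamma>\<in>Pow \<beta>. v \<gamma>)) \<and>
          (\<forall>v\<in>vert C \<alpha>. gtgt G v = (\<lambda>\<gamma>\<in>Pow \<beta>. v \<gamma> \<oplus>\<^bsub>V\<^esub> t i \<odot>\<^bsub>V\<^esub> v (insert i \<gamma>))) \<and>
          (\<forall>v\<in>vert C \<beta>. gunit G v = (\<lambda>\<gamma>\<in>Pow \<alpha>. if i \<in> \<gamma> then \<zero>\<^bsub>V\<^esub> else v \<gamma>)) \<and>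
          (\<forall>v' v. composable G v' v \<longrightarrow>
             gcomp G v' v \<in> Pow \<alpha> \<rightarrow>\<^sub>E carrier V \<and>
             (\<forall>\<gamma>. \<gamma> \<subseteq> \<beta> \<longrightarrow> gcomp G v' v \<gamma> = v \<gamma> \<and>
                gcomp G v' v (insert i \<gamma>) = v (insert i \<gamma>) \<oplus>\<^bsub>V\<^esub> v' (insert i \<gamma>))))"
      unfolding Let_def
    proof (intro allI impI; elim conjE)
      fix \<beta> i assume "\<beta> \<subseteq> {1..n}" "i \<in> {1..n} - \<beta>"
      then have sub: "insert i \<beta> \<subseteq> {1..n}" "i \<notin> \<beta>" "\<beta> \<subseteq> {1..n}" by auto
      define G where "G = edge (Gsy V t U n) \<beta> (insert i \<beta>)"
      have G: "fam_edge K V t U i \<beta> G"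
        unfolding G_def by (rule Gsy_edge[OF le_refl sub(1,2)])
      show "(\<forall>v\<in>vert (Gsy V t U n) (insert i \<beta>). gsrc G v = (\<lambda>\<gamma>\<in>Pow \<beta>. v \<gamma>)) \<and>
          (\<forall>v\<in>vert (Gsy V t U n) (insert i \<beta>).
             gtgt G v = (\<lambda>\<gamma>\<in>Pow \<beta>. v \<gamma> \<oplus>\<^bsub>V\<^esub> t i \<odot>\<^bsub>V\<^esub> v (insert i \<gamma>))) \<and>
          (\<forall>v\<in>vert (Gsy V t U n) \<beta>. gunit G v = (\<lambda>\<gamma>\<in>Pow (insert i \<beta>). if i \<in> \<gamma> then \<zero>\<^bsub>V\<^esub> else v \<gamma>)) \<and>
          (\<forall>v' v. composable G v' v \<longrightarrow>
             gcomp G v' v \<in> Pow (insert i \<beta>) \<rightarrow>\<^sub>E carrier V \<and>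
             (\<forall>\<gamma>. \<gamma> \<subseteq> \<beta> \<longrightarrow> gcomp G v' v \<gamma> = v \<gamma> \<and>
                gcomp G v' v (insert i \<gamma>) = v (insert i \<gamma>) \<oplus>\<^bsub>V\<^esub> v' (insert i \<gamma>)))"
      proof (intro conjI ballI allI impI)
        fix v assume "v \<in> vert (Gsy V t U n) (insert i \<beta>)"
        then have "v \<in> fam V (insert i \<beta>)" using vert[OF sub(1)] vset_fam by simp
        then show "gsrc G v = (\<lambda>\<gamma>\<in>Pow \<beta>. v \<gamma>)"
          "gtgt G v = (\<lambda>\<gamma>\<in>Pow \<beta>. v \<gamma> \<oplus>\<^bsub>V\<^esub> t i \<odot>\<^bsub>V\<^esub> v (insert i \<gamma>))"
          using G by (simp_all add: fam_edge_def fsrc_def ftgt_def)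
      next
        fix v assume "v \<in> vert (Gsy V t U n) \<beta>"
        then have "v \<in> fam V \<beta>" using vert[OF sub(3)] vset_fam by simp
        then show "gunit G v = (\<lambda>\<gamma>\<in>Pow (insert i \<beta>). if i \<in> \<gamma> then \<zero>\<^bsub>V\<^esub> else v \<gamma>)"
          using G by (simp add: fam_edge_def funit_def)
      next
        fix v' v assume "composable G v' v"
        note c = fam_edge_composable[OF G this]
        show "gcomp G v' v \<in> Pow (insert i \<beta>) \<rightarrow>\<^sub>E carrier V"
          using fmul_fam[OF c(3,4)] c(6) by simp
        fix \<gamma> assume "\<gamma> \<subseteq> \<beta>"
        then show "gcomp G v' v \<gamma> = v \<gamma>"
          "gcomp G v' v (insert i \<gamma>) = v (insert i \<gamma>) \<oplus>\<^bsub>V\<^esub> v' (insert i \<gamma>)"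
          using c(6) sub(2) by (simp_all add: fmul_apply')
      qed
    qed
    show "\<forall>\<alpha> \<beta> ds. \<alpha> \<subseteq> {1..n} \<and> \<beta> \<subseteq> \<alpha> \<and> distinct ds \<and> set ds = \<alpha> \<longrightarrow>
        (\<forall>v\<in>vert (Gsy V t U n) \<alpha>.
           topdown (Gsy V t U n) \<beta> \<alpha> ds v = pt (xsum K V t \<beta> v) \<and> xsum K V t \<beta> v \<in> U)"
    proof (intro allI impI ballI; elim conjE)
      fix \<alpha> \<beta> ds v
      assume a: "\<alpha> \<subseteq> {1..n}" "\<beta> \<subseteq> \<alpha>" "distinct ds" "set ds = \<alpha>" "v \<in> vert (Gsy V t U n) \<alpha>"
      then have "v \<in> vset K V t U \<alpha>" by (simp add: vert)
      then show "topdown (Gsy V t U n) \<beta> \<alpha> ds v = pt (xsum K V t \<beta> v) \<and> xsum K V t \<beta> v \<in> U"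
        using Gsy_topdown[OF a(1,3,4), of v \<beta>] xU[OF a(2)] a(2) by (simp add: Int_absorb2)
    qed
    show "\<forall>t1\<in>carrier K. \<forall>t2\<in>carrier K.
        nfold_iso 2 (nfold_perm (Transposition.transpose 1 2) (Gsy V (params2 t1 t2) U 2))
          (Gsy V (params2 t2 t1) U 2) flip \<and>
        (t1 = t2 \<longrightarrow> edge_symmetric 2 (Gsy V (params2 t1 t2) U 2))"
    proof (intro ballI conjI impI)
      fix t1 t2 assume t: "t1 \<in> carrier K" "t2 \<in> carrier K"
      show "nfold_iso 2 (nfold_perm (Transposition.transpose 1 2) (Gsy V (params2 t1 t2) U 2))
          (Gsy V (params2 t2 t1) U 2) flip"
        by (rule Gsy_flip_iso[OF module_axioms U_sub t])
      \<comment> \<open>The flip has its own two parameters and dimension 2, unrelated to the fixed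
        \<open>t\<close> and \<open>n\<close>, so the locale is instantiated afresh.\<close>
      interpret D: gsy_data K V "params2 t1 t2" U 2
        using t U_sub module_axioms by (simp add: gsy_data_def gsy_data_axioms_def params2_def)
      assume "t1 = t2"
      then show "edge_symmetric 2 (Gsy V (params2 t1 t2) U 2)"
        by (intro D.Gsy_edge_symmetric) (simp add: params2_def)
    qed
    show "\<forall>\<sigma>. \<sigma> permutes {1..n} \<longrightarrow>
        nfold_iso n (nfold_perm \<sigma> (Gsy V t U n)) (Gsy V (t \<circ> \<sigma>) U n)
          (\<lambda>\<alpha> v. \<lambda>\<gamma>\<in>Pow \<alpha>. v (\<sigma> ` \<gamma>))"
    proof (intro allI impI)
      fix \<sigma> assume "\<sigma> permutes {1..n}"
      then have "nfold_iso n (nfold_perm \<sigma> (Gsy V t U n)) (Gsy V (t \<circ> \<sigma>) U n) (perm_fam \<sigma>)"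
        by (rule Gsy_perm_iso) simp
      moreover have "(perm_fam \<sigma> :: _ \<Rightarrow> (_ \<Rightarrow> 'v) \<Rightarrow> _) = (\<lambda>\<alpha> v. \<lambda>\<gamma>\<in>Pow \<alpha>. v (\<sigma> ` \<gamma>))"
        by (simp add: perm_fam_def fun_eq_iff)
      ultimately show "nfold_iso n (nfold_perm \<sigma> (Gsy V t U n)) (Gsy V (t \<circ> \<sigma>) U n)
          (\<lambda>\<alpha> v. \<lambda>\<gamma>\<in>Pow \<alpha>. v (\<sigma> ` \<gamma>))" by simp
    qed
    show "(\<forall>i\<in>{1..n}. \<forall>j\<in>{1..n}. t i = t j) \<longrightarrow> edge_symmetric n (Gsy V t U n)"
      using Gsy_edge_symmetric by (rule impI)
    show "\<forall>(W :: ('k, 'w, 'y) module_scheme) U'. linear_set K W U' \<longrightarrow>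
        nfold_iso n (Gsy (module_prod V W) t (U \<times> U') n)
          (nfold_prod (Gsy V t U n) (Gsy W t U' n)) unzip \<and>
        (\<forall>(V1 :: ('k, 'v1, 'z1) module_scheme) U1 (W1 :: ('k, 'w1, 'y1) module_scheme) U1' f g.
           linear_set K V1 U1 \<and> linear_set K W1 U1' \<and>
           linear_set_hom K V U V1 U1 f \<and> linear_set_hom K W U' W1 U1' g \<longrightarrow>
           (\<forall>\<alpha>. \<alpha> \<subseteq> {1..n} \<longrightarrow> (\<forall>z\<in>vert (Gsy (module_prod V W) t (U \<times> U') n) \<alpha>.
              unzip \<alpha> (Gsy_map (map_prod f g) n \<alpha> z)
                = map_prod (Gsy_map f n \<alpha>) (Gsy_map g n \<alpha>) (unzip \<alpha> z))))"
    proof (intro allI impI conjI ballI)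
      fix W :: "('k, 'w, 'y) module_scheme" and U' assume "linear_set K W U'"
      then interpret W: gsy_data K W t U' n
        using t_closed by (simp add: gsy_data_def gsy_data_axioms_def linear_set_def)
      interpret gsy_data_pair K V W t U U' n ..
      show "nfold_iso n (Gsy (module_prod V W) t (U \<times> U') n)
          (nfold_prod (Gsy V t U n) (Gsy W t U' n)) unzip"
        by (rule Gsy_prod_iso)
    qed (rule unzip_Gsy_map)
  qed
qed

end
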